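(* Let $d>1$ and let $Q:=\{-1,+1\}^{\mathbb N_+}$ be endowed with the uniform product measure $\mathbb M:=(\frac12\delta_{-1}+\frac12\delta_{1})^{\otimes\mathbb N_+}$. Let $\mathcal I$ be the collection of finite subsets of $\mathbb N_+$ and, for $I\in\mathcal I$, let $W_I:=\prod_{i\in I}\varepsilon_i$ ($W_\emptyset\equiv1$) be the Walsh functions, where $\varepsilon_i:Q\to\{-1,1\}$ is the $i$-th coordinate. Let $(\Sigma_I)_{I\in\mathcal I}$ be symmetric positive definite matrices in $\mathbb R^{d\times d}$ with $$0<\alpha_I^2\le\Sigma_Iv\cdot v\le\beta_I^2\quad\text{for every }v\in\mathbb R^d,\ |v|=1,\qquad\sum_{I\in\mathcal I}\beta_I^2<\infty,$$ let $\xi_I\sim N(0,\Sigma_I)$ be independent centered Gaussian random variables in $\mathbb R^d$ indexed by $I\in\mathcal I$, and let $\mathfrak g$ be the law in $\mathcal H:=L^2(Q,\mathbb M;\mathbb R^d)$ of $\boldsymbol\xi=\sum_{I\in\mathcal I}\xi_IW_I$. For $n\ge1$ let $\mathcal I_n:=\{I\in\mathcal I:\max I=n\}$ and $A_n:=\big(\sum_{I\in\mathcal I_n}\alpha_I^2\big)^{1/2}$. If $$\sum_{n=1}^\infty\frac1{2^nA_n^d}<\infty,$$ then $\mathtt G=\iota_\sharp\mathfrak g\in\mathcal P_2(\mathcal P_2(\mathbb R^d))$ is super-G-regular, where $\iota(X):=X_\sharp\mathbb M$.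
   Context: $\mathcal P_2(\mathbb R^d)$: Borel probability measures on $\mathbb R^d$ with finite quadratic moment, with 2-Wasserstein metric; $\mathcal P_2(\mathcal P_2(\mathbb R^d))$: Borel probability measures on it with finite quadratic moment. The Walsh system is a complete orthonormal system of $L^2(Q,\mathbb M;\mathbb R)$, and the series defining $\boldsymbol\xi$ converges in $L^2$ of the underlying probability space with values in $\mathcal H$. A Gaussian measure on a separable Hilbert space is nondegenerate if every nonzero continuous linear functional has a Gaussian law with positive variance; a Borel subset of $\mathcal H$ is Gaussian-null if it is negligible for every nondegenerate Gaussian measure on $\mathcal H$. d.c. hypersurface of $\mathbb R^d$: a set $\{x+(f(x)-g(x))v:x\in v^\perp\}$ with $v\neq0$ and $f,g:v^\perp\to\mathbb R$ Lipschitz convex. $\mathcal P_2^r(\mathbb R^d)$: measures in $\mathcal P_2(\mathbb R^d)$ vanishing on all d.c. hypersurfaces. $\mathtt M\in\mathcal P_2(\mathcal P_2(\mathbb R^d))$ is super-G-regular if (i) $\mathtt M$ is concentrated on $\mathcal P_2^r(\mathbb R^d)$ and (ii) $\mathtt M(B)=0$ for every Borel $B\subset\mathcal P_2(\mathbb R^d)$ such that $\iota^{-1}(B)$ is Gaussian-null in $\mathcal H$. *)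

theory Defs
  imports "HOL-Probability.Probability"
begin

section \<open>The discrete cube and the Walsh functions\<close>

text \<open>Points of \<open>Q\<close> are functions on \<open>nat\<close> that are extensional on \<open>{1..}\<close>.\<close>

definition cube_measure :: "(nat \<Rightarrow> real) measure" where
  "cube_measure = PiM {1..} (\<lambda>_. uniform_count_measure {-1, 1})"

definition walsh_index :: "nat set set" where
  "walsh_index = {I. finite I \<and> I \<subseteq> {1..}}"

definition walsh_index_max :: "nat \<Rightarrow> nat set set" where
  "walsh_index_max n = {I \<in> walsh_index. I \<noteq> {} \<and> Max I = n}"

definition walsh :: "nat set \<Rightarrow> (nat \<Rightarrow> real) \<Rightarrow> real" where
  "walsh I q = (\<Prod>i\<in>I. q i)"

lemma prob_space_cube_measure: "prob_space cube_measure"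
  unfolding cube_measure_def
  by (intro prob_space_PiM prob_space_uniform_count_measure) auto


section \<open>The Hilbert space of square integrable maps on the cube\<close>

definition square_integrable :: "((nat \<Rightarrow> real) \<Rightarrow> 'a::euclidean_space) \<Rightarrow> bool" where
  "square_integrable f \<longleftrightarrow>
     f \<in> borel_measurable cube_measure \<and> integrable cube_measure (\<lambda>q. (norm (f q))\<^sup>2)"

definition cube_L2_rel ::
  "((nat \<Rightarrow> real) \<Rightarrow> 'a::euclidean_space) \<Rightarrow> ((nat \<Rightarrow> real) \<Rightarrow> 'a) \<Rightarrow> bool" where
  "cube_L2_rel f g \<longleftrightarrow>
     square_integrable f \<and> square_integrable g \<and> (AE q in cube_measure. f q = g q)"

lemma square_integrable_0: "square_integrable (\<lambda>_. 0)"
  by (simp add: square_integrable_def)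

lemma square_integrable_scaleR:
  "square_integrable f \<Longrightarrow> square_integrable (\<lambda>q. c *\<^sub>R f q)"
  by (auto simp: square_integrable_def power_mult_distrib)

lemma norm_add_power2_le: "(norm (x + y))\<^sup>2 \<le> 2 * (norm x)\<^sup>2 + 2 * (norm y)\<^sup>2"
  for x y :: "'a::real_normed_vector"
proof -
  have "(norm (x + y))\<^sup>2 \<le> (norm x + norm y)\<^sup>2"
    by (intro power_mono norm_triangle_ineq) auto
  also have "\<dots> \<le> 2 * (norm x)\<^sup>2 + 2 * (norm y)\<^sup>2"
    using sum_squares_bound[of "norm x" "norm y"] by (simp add: power2_sum)
  finally show ?thesis .
qed

lemma square_integrable_add:
  assumes "square_integrable f" "square_integrable g"
  shows "square_integrable (\<lambda>q. f q + g q)"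
proof -
  have [measurable]: "f \<in> borel_measurable cube_measure" "g \<in> borel_measurable cube_measure"
    using assms by (auto simp: square_integrable_def)
  have "integrable cube_measure (\<lambda>q. (norm (f q + g q))\<^sup>2)"
  proof (rule Bochner_Integration.integrable_bound)
    show "integrable cube_measure (\<lambda>q. 2 * (norm (f q))\<^sup>2 + 2 * (norm (g q))\<^sup>2)"
      using assms by (auto simp: square_integrable_def)
    show "AE q in cube_measure. norm ((norm (f q + g q))\<^sup>2)
            \<le> norm (2 * (norm (f q))\<^sup>2 + 2 * (norm (g q))\<^sup>2)"
      using norm_add_power2_le[of "f _" "g _"] by auto
  qed measurable
  then show ?thesis by (auto simp: square_integrable_def)
qed

lemma square_integrable_minus:
  "square_integrable f \<Longrightarrow> square_integrable (\<lambda>q. - f q)"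
  using square_integrable_scaleR[of f "-1"] by simp

lemma square_integrable_diff:
  "square_integrable f \<Longrightarrow> square_integrable g \<Longrightarrow> square_integrable (\<lambda>q. f q - g q)"
  using square_integrable_add[of f "\<lambda>q. - g q"] square_integrable_minus[of g] by simp

lemma square_integrable_inner:
  assumes "square_integrable f" "square_integrable g"
  shows "integrable cube_measure (\<lambda>q. f q \<bullet> g q)"
proof -
  have [measurable]: "f \<in> borel_measurable cube_measure" "g \<in> borel_measurable cube_measure"
    using assms by (auto simp: square_integrable_def)
  show ?thesis
  proof (rule Bochner_Integration.integrable_bound)
    show "integrable cube_measure (\<lambda>q. (norm (f q))\<^sup>2 + (norm (g q))\<^sup>2)"
      using assms by (auto simp: square_integrable_def)
    have "\<bar>f q \<bullet> g q\<bar> \<le> (norm (f q))\<^sup>2 + (norm (g q))\<^sup>2" for q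
    proof -
      have "\<bar>f q \<bullet> g q\<bar> \<le> norm (f q) * norm (g q)"
        by (rule Cauchy_Schwarz_ineq2)
      moreover have "2 * norm (f q) * norm (g q) \<le> (norm (f q))\<^sup>2 + (norm (g q))\<^sup>2"
        by (rule sum_squares_bound)
      moreover have "0 \<le> norm (f q) * norm (g q)" by simp
      ultimately show ?thesis by linarith
    qed
    then show "AE q in cube_measure. norm (f q \<bullet> g q)
        \<le> norm ((norm (f q))\<^sup>2 + (norm (g q))\<^sup>2)"
      by auto
  qed measurable
qed

quotient_type (overloaded) 'a cube_L2 =
  "(nat \<Rightarrow> real) \<Rightarrow> 'a::euclidean_space" / partial: cube_L2_rel
proof (rule part_equivpI)
  show "\<exists>f::(nat \<Rightarrow> real) \<Rightarrow> 'a. cube_L2_rel f f"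
    by (rule exI[of _ "\<lambda>_. 0"]) (simp add: cube_L2_rel_def square_integrable_0)
  show "symp (cube_L2_rel :: ((nat \<Rightarrow> real) \<Rightarrow> 'a) \<Rightarrow> _)"
    by (rule sympI) (auto simp: cube_L2_rel_def elim: eventually_mono)
  show "transp (cube_L2_rel :: ((nat \<Rightarrow> real) \<Rightarrow> 'a) \<Rightarrow> _)"
    by (rule transpI) (auto simp: cube_L2_rel_def elim: eventually_elim2)
qed

instantiation cube_L2 :: (euclidean_space) real_inner
begin

lift_definition zero_cube_L2 :: "'a cube_L2" is "\<lambda>_. 0"
  by (simp add: cube_L2_rel_def square_integrable_0)

lift_definition plus_cube_L2 :: "'a cube_L2 \<Rightarrow> 'a cube_L2 \<Rightarrow> 'a cube_L2"
  is "\<lambda>f g q. f q + g q"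
  by (auto simp: cube_L2_rel_def intro: square_integrable_add)

lift_definition minus_cube_L2 :: "'a cube_L2 \<Rightarrow> 'a cube_L2 \<Rightarrow> 'a cube_L2"
  is "\<lambda>f g q. f q - g q"
  by (auto simp: cube_L2_rel_def intro: square_integrable_diff)

lift_definition uminus_cube_L2 :: "'a cube_L2 \<Rightarrow> 'a cube_L2" is "\<lambda>f q. - f q"
  by (auto simp: cube_L2_rel_def intro: square_integrable_minus)

lift_definition scaleR_cube_L2 :: "real \<Rightarrow> 'a cube_L2 \<Rightarrow> 'a cube_L2"
  is "\<lambda>c f q. c *\<^sub>R f q"
  by (auto simp: cube_L2_rel_def intro: square_integrable_scaleR)

lift_definition inner_cube_L2 :: "'a cube_L2 \<Rightarrow> 'a cube_L2 \<Rightarrow> real"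
  is "\<lambda>f g. \<integral>q. f q \<bullet> g q \<partial>cube_measure"
proof -
  fix f f' g g' :: "(nat \<Rightarrow> real) \<Rightarrow> 'a"
  assume *: "cube_L2_rel f f'" "cube_L2_rel g g'"
  then have [measurable]:
    "f \<in> borel_measurable cube_measure" "g \<in> borel_measurable cube_measure"
    "f' \<in> borel_measurable cube_measure" "g' \<in> borel_measurable cube_measure"
    by (auto simp: cube_L2_rel_def square_integrable_def)
  show "(\<integral>q. f q \<bullet> g q \<partial>cube_measure) = (\<integral>q. f' q \<bullet> g' q \<partial>cube_measure)"
    by (rule integral_cong_AE) (use * in \<open>auto simp: cube_L2_rel_def\<close>)
qed

definition norm_cube_L2 :: "'a cube_L2 \<Rightarrow> real" where
  "norm_cube_L2 X = sqrt (X \<bullet> X)"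

definition sgn_cube_L2 :: "'a cube_L2 \<Rightarrow> 'a cube_L2" where
  "sgn_cube_L2 X = inverse (norm X) *\<^sub>R X"

definition dist_cube_L2 :: "'a cube_L2 \<Rightarrow> 'a cube_L2 \<Rightarrow> real" where
  "dist_cube_L2 X Y = norm (X - Y)"

definition uniformity_cube_L2 :: "('a cube_L2 \<times> 'a cube_L2) filter" where
  "uniformity_cube_L2 = (INF e\<in>{0 <..}. principal {(X, Y). dist X Y < e})"

definition open_cube_L2 :: "'a cube_L2 set \<Rightarrow> bool" where
  "open_cube_L2 U \<longleftrightarrow>
     (\<forall>X\<in>U. eventually (\<lambda>(X', Y). X' = X \<longrightarrow> Y \<in> U) uniformity)"

instance
proof
  fix X Y Z :: "'a cube_L2" and a b :: real
  show "X + Y + Z = X + (Y + Z)"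
    by transfer (auto simp: cube_L2_rel_def add.assoc intro!: square_integrable_add)
  show "X + Y = Y + X"
    by transfer (auto simp: cube_L2_rel_def add.commute intro!: square_integrable_add)
  show "0 + X = X"
    by transfer (auto simp: cube_L2_rel_def)
  show "- X + X = 0"
    by transfer (auto simp: cube_L2_rel_def square_integrable_0)
  show "X - Y = X + - Y"
    by transfer (auto simp: cube_L2_rel_def intro!: square_integrable_diff)
  show "a *\<^sub>R (X + Y) = a *\<^sub>R X + a *\<^sub>R Y"
    by transfer (auto simp: cube_L2_rel_def scaleR_add_right
        intro!: square_integrable_add square_integrable_scaleR)
  show "(a + b) *\<^sub>R X = a *\<^sub>R X + b *\<^sub>R X"
    by transfer (auto simp: cube_L2_rel_def scaleR_add_left
        intro!: square_integrable_add square_integrable_scaleR)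
  show "a *\<^sub>R b *\<^sub>R X = (a * b) *\<^sub>R X"
    by transfer (auto simp: cube_L2_rel_def intro!: square_integrable_scaleR)
  show "1 *\<^sub>R X = X"
    by transfer (auto simp: cube_L2_rel_def)
  show "X \<bullet> Y = Y \<bullet> X"
    by transfer (simp add: inner_commute)
  show "(X + Y) \<bullet> Z = X \<bullet> Z + Y \<bullet> Z"
    by transfer (auto simp: cube_L2_rel_def inner_add_left
        intro!: Bochner_Integration.integral_add square_integrable_inner)
  show "(a *\<^sub>R X) \<bullet> Y = a * (X \<bullet> Y)"
    by transfer simp
  show "0 \<le> X \<bullet> X"
    by transfer (auto intro!: integral_nonneg_AE)
  show "X \<bullet> X = 0 \<longleftrightarrow> X = 0"
  proof transfer
    fix f :: "(nat \<Rightarrow> real) \<Rightarrow> 'a"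
    assume "cube_L2_rel f f"
    then have f: "square_integrable f" by (simp add: cube_L2_rel_def)
    have "(\<integral>q. f q \<bullet> f q \<partial>cube_measure) = 0 \<longleftrightarrow> (AE q in cube_measure. f q \<bullet> f q = 0)"
      by (rule integral_nonneg_eq_0_iff_AE) (auto intro: square_integrable_inner f)
    then show "(\<integral>q. f q \<bullet> f q \<partial>cube_measure) = 0 \<longleftrightarrow> cube_L2_rel f (\<lambda>_. 0)"
      using f by (auto simp: cube_L2_rel_def square_integrable_0)
  qed
  show "norm X = sqrt (X \<bullet> X)"
    by (rule norm_cube_L2_def)
  show "sgn X = inverse (norm X) *\<^sub>R X"
    by (rule sgn_cube_L2_def)
  show "dist X Y = norm (X - Y)"
    by (rule dist_cube_L2_def)
  show "(uniformity :: ('a cube_L2 \<times> 'a cube_L2) filter)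
      = (INF e\<in>{0 <..}. principal {(X, Y). dist X Y < e})"
    by (rule uniformity_cube_L2_def)
  show "open U = (\<forall>X\<in>U. eventually (\<lambda>(X', Y). X' = X \<longrightarrow> Y \<in> U) uniformity)"
    for U :: "'a cube_L2 set"
    by (rule open_cube_L2_def)
qed

end


section \<open>Wasserstein spaces\<close>

text \<open>The base point of the quadratic moment is irrelevant whenever \<open>D\<close> is a metric.
  The metric is a parameter because the notion is used both for the Euclidean distance and for
  the Wasserstein distance.\<close>

definition P2 :: "('a \<Rightarrow> 'a \<Rightarrow> real) \<Rightarrow> 'a::topological_space measure set" where
  "P2 D = {\<mu>. prob_space \<mu> \<and> sets \<mu> = sets borel \<and>
              (\<exists>x\<^sub>0. (\<integral>\<^sup>+ x. ennreal ((D x x\<^sub>0)\<^sup>2) \<partial>\<mu>) < \<infinity>)}"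

typedef (overloaded) 'a prob2 = "P2 dist :: 'a::euclidean_space measure set"
  morphisms measure_of_prob2 Abs_prob2
proof
  have "(\<integral>\<^sup>+ x. ennreal ((dist x 0)\<^sup>2) \<partial>return borel (0::'a)) = 0"
    by (subst nn_integral_return) auto
  then show "return borel (0::'a) \<in> P2 dist"
    unfolding P2_def by (auto intro!: prob_space_return exI[of _ 0])
qed

setup_lifting type_definition_prob2

definition couplings ::
  "'a::topological_space measure \<Rightarrow> 'a measure \<Rightarrow> ('a \<times> 'a) measure set" where
  "couplings \<mu> \<nu> = {\<pi>. sets \<pi> = sets (borel \<Otimes>\<^sub>M borel) \<and>
                       distr \<pi> borel fst = \<mu> \<and> distr \<pi> borel snd = \<nu>}"

definition W2 :: "'a::euclidean_space prob2 \<Rightarrow> 'a prob2 \<Rightarrow> real" where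
  "W2 \<mu> \<nu> = sqrt (enn2real
     (INF \<pi>\<in>couplings (measure_of_prob2 \<mu>) (measure_of_prob2 \<nu>).
        \<integral>\<^sup>+ z. ennreal ((dist (fst z) (snd z))\<^sup>2) \<partial>\<pi>))"

text \<open>The topology induced by \<^const>\<open>W2\<close>; \<^term>\<open>borel\<close> on this type is the corresponding
  Borel \<open>\<sigma>\<close>-algebra.\<close>

instantiation prob2 :: (euclidean_space) topological_space
begin

definition open_prob2 :: "'a prob2 set \<Rightarrow> bool" where
  "open_prob2 U \<longleftrightarrow> (\<forall>\<mu>\<in>U. \<exists>e>0. \<forall>\<nu>. W2 \<mu> \<nu> < e \<longrightarrow> \<nu> \<in> U)"

instance
proof
  show "open (UNIV :: 'a prob2 set)"
    by (auto simp: open_prob2_def intro: exI[of _ 1])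
  show "open (S \<inter> T)" if ST: "open S" "open T" for S T :: "'a prob2 set"
    unfolding open_prob2_def
  proof
    fix \<mu> assume "\<mu> \<in> S \<inter> T"
    then obtain e e' where "e > 0" "\<forall>\<nu>. W2 \<mu> \<nu> < e \<longrightarrow> \<nu> \<in> S"
      and "e' > 0" "\<forall>\<nu>. W2 \<mu> \<nu> < e' \<longrightarrow> \<nu> \<in> T"
      using ST unfolding open_prob2_def by blast
    then show "\<exists>e>0. \<forall>\<nu>. W2 \<mu> \<nu> < e \<longrightarrow> \<nu> \<in> S \<inter> T"
      by (intro exI[of _ "min e e'"]) auto
  qed
  show "open (\<Union>K)" if "\<forall>S\<in>K. open S" for K :: "'a prob2 set set"
    using that unfolding open_prob2_def by (meson Union_iff)
qed

end

lift_definition iota :: "'a::euclidean_space cube_L2 \<Rightarrow> 'a prob2"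
  is "\<lambda>X. distr cube_measure borel X"
proof -
  interpret Q: prob_space cube_measure by (rule prob_space_cube_measure)
  have P2: "distr cube_measure borel f \<in> P2 dist" if "square_integrable f"
    for f :: "(nat \<Rightarrow> real) \<Rightarrow> 'a"
  proof -
    have f [measurable]: "f \<in> borel_measurable cube_measure"
      and i: "integrable cube_measure (\<lambda>q. (norm (f q))\<^sup>2)"
      using that by (auto simp: square_integrable_def)
    have "(\<integral>\<^sup>+ x. ennreal ((dist x 0)\<^sup>2) \<partial>distr cube_measure borel f)
        = (\<integral>\<^sup>+ q. ennreal ((norm (f q))\<^sup>2) \<partial>cube_measure)"
      by (subst nn_integral_distr) auto
    also have "\<dots> < \<infinity>"
      using i by (subst nn_integral_eq_integral) auto
    finally show ?thesis
      unfolding P2_def by (auto intro!: Q.prob_space_distr exI[of _ 0])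
  qed
  fix f g :: "(nat \<Rightarrow> real) \<Rightarrow> 'a"
  assume *: "cube_L2_rel f g"
  have "distr cube_measure borel f = distr cube_measure borel g"
    by (rule distr_cong_AE) (use * in \<open>auto simp: cube_L2_rel_def square_integrable_def\<close>)
  with * show "distr cube_measure borel f \<in> P2 dist \<and>
      distr cube_measure borel f = distr cube_measure borel g"
    by (auto simp: cube_L2_rel_def intro: P2)
qed


section \<open>Gaussian measures\<close>

text \<open>Second argument: the variance. \<^const>\<open>normal_density\<close> takes the standard deviation.\<close>

definition normal_law :: "real \<Rightarrow> real \<Rightarrow> real measure" where
  "normal_law m s2 =
     (if s2 = 0 then return borel m else density lborel (normal_density m (sqrt s2)))"

definition gaussian_measure :: "'h::real_normed_vector measure \<Rightarrow> bool" where
  "gaussian_measure \<gamma> \<longleftrightarrow> prob_space \<gamma> \<and> sets \<gamma> = sets borel \<and>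
     (\<forall>L::'h \<Rightarrow> real. bounded_linear L \<longrightarrow>
        (\<exists>m s2. s2 \<ge> 0 \<and> distr \<gamma> borel L = normal_law m s2))"

definition nondegenerate_gaussian :: "'h::real_normed_vector measure \<Rightarrow> bool" where
  "nondegenerate_gaussian \<gamma> \<longleftrightarrow> gaussian_measure \<gamma> \<and>
     (\<forall>L::'h \<Rightarrow> real. bounded_linear L \<and> L \<noteq> (\<lambda>_. 0) \<longrightarrow>
        (\<exists>m s2. s2 > 0 \<and> distr \<gamma> borel L = normal_law m s2))"

definition gaussian_null :: "'h::real_normed_vector set \<Rightarrow> bool" where
  "gaussian_null N \<longleftrightarrow> N \<in> sets borel \<and>
     (\<forall>\<gamma>. nondegenerate_gaussian \<gamma> \<longrightarrow> emeasure \<gamma> N = 0)"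

text \<open>The centred Gaussian law \<open>N(0, \<Sigma>)\<close> on \<open>\<real>\<^sup>d\<close>, characterised through the laws of the
  linear functionals \<open>x \<mapsto> v \<bullet> x\<close>, as for the measures above.\<close>

definition centered_gaussian :: "real^'d^'d \<Rightarrow> (real^'d) measure \<Rightarrow> bool" where
  "centered_gaussian \<Sigma> \<gamma> \<longleftrightarrow> prob_space \<gamma> \<and> sets \<gamma> = sets borel \<and>
     (\<forall>v. distr \<gamma> borel (\<lambda>x. v \<bullet> x) = normal_law 0 ((\<Sigma> *v v) \<bullet> v))"


section \<open>Super-G-regular measures\<close>

definition dc_hypersurface :: "'a::euclidean_space set \<Rightarrow> bool" where
  "dc_hypersurface S \<longleftrightarrow> (\<exists>v f g. v \<noteq> 0 \<and>
     convex_on {x. orthogonal v x} f \<and> (\<exists>C. C-lipschitz_on {x. orthogonal v x} f) \<and>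
     convex_on {x. orthogonal v x} g \<and> (\<exists>C. C-lipschitz_on {x. orthogonal v x} g) \<and>
     S = {x + (f x - g x) *\<^sub>R v | x. orthogonal v x})"

definition P2r :: "'a::euclidean_space prob2 set" where
  "P2r = {\<mu>. \<forall>S. dc_hypersurface S \<longrightarrow> emeasure (measure_of_prob2 \<mu>) S = 0}"

definition super_G_regular :: "'a::euclidean_space prob2 measure \<Rightarrow> bool" where
  "super_G_regular M \<longleftrightarrow> M \<in> P2 W2 \<and>
     (AE \<mu> in M. \<mu> \<in> P2r) \<and>
     (\<forall>B\<in>sets borel. gaussian_null (iota -` B) \<longrightarrow> emeasure M B = 0)"


section \<open>Gaussian Walsh series\<close>

text \<open>\<open>\<Xi> = (\<Sum>I. \<xi>\<^sub>I W\<^sub>I)\<close>, the series converging unconditionally in \<open>L\<^sup>2(P; \<H>)\<close>: the partial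
  sums over finite sets of indices form a net. \<^const>\<open>abs_cube_L2\<close> maps a square integrable
  function to its class.\<close>

definition is_walsh_series ::
  "'w measure \<Rightarrow> (nat set \<Rightarrow> 'w \<Rightarrow> 'a::euclidean_space) \<Rightarrow> ('w \<Rightarrow> 'a cube_L2) \<Rightarrow> bool" where
  "is_walsh_series P \<xi> \<Xi> \<longleftrightarrow> \<Xi> \<in> borel_measurable P \<and>
     ((\<lambda>F. \<integral>\<^sup>+ \<omega>. ennreal ((norm (\<Xi> \<omega> -
          (\<Sum>I\<in>F. abs_cube_L2 (\<lambda>q. walsh I q *\<^sub>R \<xi> I \<omega>))))\<^sup>2) \<partial>P)
        \<longlongrightarrow> 0) (finite_subsets_at_top walsh_index)"

end

theory Submission
  imports Defs
begin

text \<open>Let \<open>J\<^sub>r(\<mu>) = \<integral>\<integral> exp (- \<bar>x - y\<bar>\<^sup>2 / 2r\<^sup>2) d\<mu> d\<mu>\<close>. A probability measure with \<open>J\<^sub>r(\<mu>) \<le> C r\<^sup>d\<close> along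
  some sequence \<open>r \<rightarrow> 0\<close> is absolutely continuous, hence vanishes on d.c. hypersurfaces, which are
  Lipschitz graphs. Two points of the cube first differ at coordinate \<open>n\<close> with probability \<open>2\<^sup>-\<^sup>n\<close>; then
  all \<open>W\<^sub>I\<close> with \<open>max I = n\<close> take opposite values, so the difference of the values of the random map is
  Gaussian with covariance at least \<open>A\<^sub>n\<^sup>2\<close> and the expected kernel is at most \<open>(r / A\<^sub>n)\<^sup>d\<close>. Summation
  over \<open>n\<close> gives \<open>E J\<^sub>r \<le> K r\<^sup>d\<close>, and Fatou's lemma yields condition (i). For condition (ii) it
  suffices that the law on the Hilbert space is a nondegenerate Gaussian: by Levy's uniqueness
  theorem every functional is normal, with positive variance because the Walsh system is total.\<close>

section \<open>The Gaussian energy and the Wasserstein distance\<close>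

text \<open>Two gaps separate the pointwise computation from the random element
  \<open>\<Xi>\<close>. It is only an L2 limit and has no values at points of the cube, so the
  kernel is estimated for the finite sums \<open>partial N\<close>; the bound reaches
  \<open>\<Xi>\<close> because, at fixed radius, the energy is Lipschitz for \<open>W2\<close> and
  \<open>iota\<close> is 1-Lipschitz. Pairs of points that agree in the first N coordinates give the
  same value of \<open>partial N\<close> and cost 2^-N, hence N tends to infinity before r tends to
  0. The second gap is measurability: neither the triangle inequality for \<open>W2\<close> nor
  measurability of the class-valued partial sums is established. Measurability is therefore drawn
  from real quantities, either continuous for \<open>W2\<close>-balls or integrals of explicit
  kernels, and everything else occurs only inside upper bounds. The Gaussian kernel serves all these
  purposes: it is bounded and Lipschitz, it is at least exp(-2) at distances below 2r, and it is an
  average of characters, so independence and characteristic functions suffice and no density of a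
  Gaussian vector has to be written down.\<close>

lemma gaussian_kernel_Lipschitz:
  fixes r u v :: real
  assumes "r > 0"
  shows "\<bar>exp (- u\<^sup>2 / (2 * r\<^sup>2)) - exp (- v\<^sup>2 / (2 * r\<^sup>2))\<bar> \<le> \<bar>u - v\<bar> / r"
proof -
  \<comment> \<open>Scale-free form of the derivative: with \<open>t = z / r\<close> the derivative
    of the kernel at \<open>z\<close> has absolute value \<open>1 / r\<close> times this
    quantity.\<close>
  have bound: "\<bar>t\<bar> * exp (- t\<^sup>2 / 2) \<le> 1" for t :: real
  proof -
    have "\<bar>t\<bar> \<le> 1 + t\<^sup>2 / 2"
      using zero_le_power2[of "\<bar>t\<bar> - 1"] by (simp add: power2_diff)
    also have "\<dots> \<le> exp (t\<^sup>2 / 2)"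
      by (rule exp_ge_add_one_self)
    finally show ?thesis
      by (simp add: exp_minus field_simps)
  qed
  have "norm (exp (- u\<^sup>2 / (2 * r\<^sup>2)) - exp (- v\<^sup>2 / (2 * r\<^sup>2))) \<le> (1 / r) * norm (u - v)"
  proof (rule field_differentiable_bound[of UNIV _ "\<lambda>u. - u / r\<^sup>2 * exp (- u\<^sup>2 / (2 * r\<^sup>2))"])
    fix z :: real
    show "((\<lambda>u. exp (- u\<^sup>2 / (2 * r\<^sup>2))) has_field_derivative
        - z / r\<^sup>2 * exp (- z\<^sup>2 / (2 * r\<^sup>2))) (at z within UNIV)"
      using assms by (auto intro!: derivative_eq_intros simp: field_simps power2_eq_square)
    have "\<bar>z / r\<bar> * exp (- (z / r)\<^sup>2 / 2) / r \<le> 1 / r"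
      using bound[of "z / r"] assms by (intro divide_right_mono) auto
    moreover have "norm (- z / r\<^sup>2 * exp (- z\<^sup>2 / (2 * r\<^sup>2))) =
        \<bar>z / r\<bar> * exp (- (z / r)\<^sup>2 / 2) / r"
      using assms by (simp add: abs_mult power_divide power2_eq_square mult.commute)
    ultimately show "norm (- z / r\<^sup>2 * exp (- z\<^sup>2 / (2 * r\<^sup>2))) \<le> 1 / r"
      by linarith
  qed auto
  then show ?thesis by simp
qed

lemma (in prob_space) nn_integral_abs_le_of_square:
  assumes [measurable]: "f \<in> borel_measurable M"
    and le: "(\<integral>\<^sup>+x. ennreal ((f x)\<^sup>2) \<partial>M) \<le> ennreal (c\<^sup>2)" and "c \<ge> 0"
  shows "(\<integral>\<^sup>+x. ennreal \<bar>f x\<bar> \<partial>M) \<le> ennreal c"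
proof -
  have "(\<integral>\<^sup>+x. ennreal \<bar>f x\<bar> * 1 \<partial>M)\<^sup>2 \<le> (\<integral>\<^sup>+x. (ennreal \<bar>f x\<bar>)\<^sup>2 \<partial>M) * (\<integral>\<^sup>+x. 1\<^sup>2 \<partial>M)"
    by (rule Cauchy_Schwarz_nn_integral) auto
  also have "\<dots> = (\<integral>\<^sup>+x. ennreal ((f x)\<^sup>2) \<partial>M)"
    by (simp add: ennreal_power emeasure_space_1)
  finally have "(\<integral>\<^sup>+x. ennreal \<bar>f x\<bar> \<partial>M)\<^sup>2 \<le> (ennreal c)\<^sup>2"
    using le \<open>c \<ge> 0\<close> by (simp add: ennreal_power)
  then show ?thesis
    using \<open>c \<ge> 0\<close>
    by (cases "\<integral>\<^sup>+x. ennreal \<bar>f x\<bar> \<partial>M")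
      (auto simp: ennreal_power abs_le_square_iff[symmetric] top_unique)
qed

definition gaussian_energy :: "real \<Rightarrow> 'a::euclidean_space measure \<Rightarrow> real" where
  "gaussian_energy r \<mu> =
     (\<integral>z. exp (- (dist (fst z) (snd z))\<^sup>2 / (2 * r\<^sup>2)) \<partial>(\<mu> \<Otimes>\<^sub>M \<mu>))"

lemma gaussian_energy_nonneg: "0 \<le> gaussian_energy r \<mu>"
  by (simp add: gaussian_energy_def)

text \<open>Energies of different measures become comparable once they are pulled back to a common
  space: a coupling in the next estimate, the cube for values of \<open>iota\<close>.\<close>

lemma gaussian_energy_distr:
  fixes f :: "'b \<Rightarrow> 'a::euclidean_space"
  assumes "prob_space M" and f: "f \<in> borel_measurable M"
  shows "gaussian_energy r (distr M borel f) =
     (\<integral>z. exp (- (dist (f (fst z)) (f (snd z)))\<^sup>2 / (2 * r\<^sup>2)) \<partial>(M \<Otimes>\<^sub>M M))"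
proof -
  interpret M: prob_space M by fact
  interpret N: prob_space "distr M borel f" by (rule M.prob_space_distr) fact
  have "distr M borel f \<Otimes>\<^sub>M distr M borel f =
      distr (M \<Otimes>\<^sub>M M) (borel \<Otimes>\<^sub>M borel) (\<lambda>(x, y). (f x, f y))"
    by (rule pair_measure_distr[OF f f]) unfold_locales
  then show ?thesis
    unfolding gaussian_energy_def using f
    by (simp add: integral_distr case_prod_beta')
qed

lemma prob_space_coupling:
  assumes "\<pi> \<in> couplings \<mu> \<nu>" "prob_space \<mu>"
  shows "prob_space \<pi>"
  using assms unfolding couplings_def
  by (auto intro!: prob_space_distrD[of fst \<pi> borel])

text \<open>Draw two independent pairs from the coupling. The distance between the two first
  components differs from the distance between the two second components by at most the two
  displacements, each of mean at most c by Cauchy-Schwarz; the kernel is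
  \<open>1 / r\<close>-Lipschitz in the distance.\<close>

lemma gaussian_energy_coupling_le:
  fixes \<mu> \<nu> :: "'a::euclidean_space measure"
  assumes \<pi>: "\<pi> \<in> couplings \<mu> \<nu>" and "prob_space \<mu>" "r > 0" "c \<ge> 0"
    and cost: "(\<integral>\<^sup>+z. ennreal ((dist (fst z) (snd z))\<^sup>2) \<partial>\<pi>) \<le> ennreal (c\<^sup>2)"
  shows "\<bar>gaussian_energy r \<mu> - gaussian_energy r \<nu>\<bar> \<le> 2 * c / r"
proof -
  interpret \<pi>: prob_space \<pi> by (rule prob_space_coupling) fact+
  interpret \<pi>\<pi>: pair_prob_space \<pi> \<pi> ..
  have [measurable_cong]: "sets \<pi> = sets (borel \<Otimes>\<^sub>M borel)"
    and \<mu>: "\<mu> = distr \<pi> borel fst" and \<nu>: "\<nu> = distr \<pi> borel snd"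
    using \<pi> by (auto simp: couplings_def)
  define k :: "'a \<Rightarrow> 'a \<Rightarrow> real" where "k x y = exp (- (dist x y)\<^sup>2 / (2 * r\<^sup>2))" for x y
  have k1: "\<bar>k x y\<bar> \<le> 1" for x y
    by (simp add: k_def)
  have [measurable]: "(\<lambda>z. k (f z) (g z)) \<in> borel_measurable M"
    if "f \<in> borel_measurable M" "g \<in> borel_measurable M" for f g and M :: "'c measure"
    using that unfolding k_def by measurable
  have int: "integrable (\<pi> \<Otimes>\<^sub>M \<pi>) (\<lambda>z. k (f z) (g z))"
    if [measurable]: "f \<in> borel_measurable (\<pi> \<Otimes>\<^sub>M \<pi>)" "g \<in> borel_measurable (\<pi> \<Otimes>\<^sub>M \<pi>)" for f g
    by (rule \<pi>\<pi>.integrable_const_bound[where B=1]) (use k1 in auto)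
  have "gaussian_energy r \<mu> - gaussian_energy r \<nu> =
      (\<integral>z. k (fst (fst z)) (fst (snd z)) - k (snd (fst z)) (snd (snd z)) \<partial>(\<pi> \<Otimes>\<^sub>M \<pi>))"
    unfolding \<mu> \<nu>
    by (subst Bochner_Integration.integral_diff[OF int int])
      (auto simp: gaussian_energy_distr \<pi>.prob_space_axioms k_def)
  then have "ennreal \<bar>gaussian_energy r \<mu> - gaussian_energy r \<nu>\<bar> \<le>
      (\<integral>\<^sup>+z. norm (k (fst (fst z)) (fst (snd z)) - k (snd (fst z)) (snd (snd z))) \<partial>(\<pi> \<Otimes>\<^sub>M \<pi>))"
    using integral_norm_bound_ennreal[of "\<pi> \<Otimes>\<^sub>M \<pi>"
        "\<lambda>z. k (fst (fst z)) (fst (snd z)) - k (snd (fst z)) (snd (snd z))"]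
    by (simp add: int)
  also have "\<dots> \<le> (\<integral>\<^sup>+z. ennreal (1 / r) * (ennreal (dist (fst (fst z)) (snd (fst z))) +
      ennreal (dist (fst (snd z)) (snd (snd z)))) \<partial>(\<pi> \<Otimes>\<^sub>M \<pi>))"
  proof (rule nn_integral_mono)
    fix z :: "('a \<times> 'a) \<times> ('a \<times> 'a)"
    have "\<bar>dist (fst (fst z)) (fst (snd z)) - dist (snd (fst z)) (snd (snd z))\<bar>
        \<le> dist (fst (fst z)) (snd (fst z)) + dist (fst (snd z)) (snd (snd z))"
      by (smt (verit) dist_commute dist_triangle)
    then have "\<bar>k (fst (fst z)) (fst (snd z)) - k (snd (fst z)) (snd (snd z))\<bar>
        \<le> (dist (fst (fst z)) (snd (fst z)) + dist (fst (snd z)) (snd (snd z))) / r"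
      using gaussian_kernel_Lipschitz[OF \<open>r > 0\<close>, of "dist (fst (fst z)) (fst (snd z))"
          "dist (snd (fst z)) (snd (snd z))"] \<open>r > 0\<close>
      unfolding k_def by (smt (verit) divide_right_mono)
    then show "ennreal (norm (k (fst (fst z)) (fst (snd z)) - k (snd (fst z)) (snd (snd z)))) \<le>
        ennreal (1 / r) * (ennreal (dist (fst (fst z)) (snd (fst z))) +
          ennreal (dist (fst (snd z)) (snd (snd z))))"
      using \<open>r > 0\<close>
      by (simp flip: ennreal_plus ennreal_mult add: ennreal_leI)
  qed
  also have "\<dots> = ennreal (1 / r) *
      ((\<integral>\<^sup>+z. ennreal (dist (fst (fst z)) (snd (fst z))) \<partial>(\<pi> \<Otimes>\<^sub>M \<pi>)) +
       (\<integral>\<^sup>+z. ennreal (dist (fst (snd z)) (snd (snd z))) \<partial>(\<pi> \<Otimes>\<^sub>M \<pi>)))"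
    by (simp add: nn_integral_cmult nn_integral_add)
  also have "(\<integral>\<^sup>+z. ennreal (dist (fst (fst z)) (snd (fst z))) \<partial>(\<pi> \<Otimes>\<^sub>M \<pi>)) =
      (\<integral>\<^sup>+a. ennreal (dist (fst a) (snd a)) \<partial>\<pi>)"
    by (subst \<pi>.nn_integral_fst[symmetric]) (auto simp: \<pi>.emeasure_space_1)
  also have "(\<integral>\<^sup>+z. ennreal (dist (fst (snd z)) (snd (snd z))) \<partial>(\<pi> \<Otimes>\<^sub>M \<pi>)) =
      (\<integral>\<^sup>+a. ennreal (dist (fst a) (snd a)) \<partial>\<pi>)"
    by (subst \<pi>.nn_integral_fst[symmetric]) (auto simp: \<pi>.emeasure_space_1)
  also have "(\<integral>\<^sup>+a. ennreal (dist (fst a) (snd a)) \<partial>\<pi>) \<le> ennreal c"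
    using \<pi>.nn_integral_abs_le_of_square[of "\<lambda>a. dist (fst a) (snd a)" c] cost \<open>c \<ge> 0\<close>
    by simp
  finally have "ennreal \<bar>gaussian_energy r \<mu> - gaussian_energy r \<nu>\<bar>
      \<le> ennreal (1 / r) * (ennreal c + ennreal c)"
    by (simp add: add_mono mult_left_mono)
  also have "\<dots> = ennreal (2 * c / r)"
    using \<open>r > 0\<close> \<open>c \<ge> 0\<close> by (simp flip: ennreal_plus ennreal_mult)
  finally show ?thesis
    using \<open>r > 0\<close> \<open>c \<ge> 0\<close> by (subst (asm) ennreal_le_iff) auto
qed

text \<open>The competitor that makes the transport cost finite.\<close>

lemma prod_coupling:
  fixes \<mu> \<nu> :: "'a::euclidean_space measure"
  assumes "prob_space \<mu>" "prob_space \<nu>" and [measurable_cong]: "sets \<mu> = sets borel" "sets \<nu> = sets borel"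
  shows "\<mu> \<Otimes>\<^sub>M \<nu> \<in> couplings \<mu> \<nu>"
proof -
  interpret \<mu>: prob_space \<mu> by fact
  interpret \<nu>: prob_space \<nu> by fact
  interpret pair_prob_space \<mu> \<nu> ..
  have 1: "distr (\<mu> \<Otimes>\<^sub>M \<nu>) borel fst = \<mu>"
  proof (rule measure_eqI)
    fix X assume "X \<in> sets (distr (\<mu> \<Otimes>\<^sub>M \<nu>) borel fst)"
    then have [measurable]: "X \<in> sets \<mu>" and "X \<in> sets borel" by (simp_all add: assms)
    then have X: "X \<subseteq> space \<mu>" by (intro sets.sets_into_space)
    have "emeasure (distr (\<mu> \<Otimes>\<^sub>M \<nu>) borel fst) X = emeasure (\<mu> \<Otimes>\<^sub>M \<nu>) (X \<times> space \<nu>)"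
      using X \<open>X \<in> sets borel\<close> by (subst emeasure_distr)
        (auto simp: assms space_pair_measure intro!: arg_cong[where f="emeasure _"])
    also have "\<dots> = emeasure \<mu> X"
      by (simp add: \<nu>.emeasure_pair_measure_Times \<nu>.emeasure_space_1)
    finally show "emeasure (distr (\<mu> \<Otimes>\<^sub>M \<nu>) borel fst) X = emeasure \<mu> X" .
  qed (simp add: assms)
  have 2: "distr (\<mu> \<Otimes>\<^sub>M \<nu>) borel snd = \<nu>"
  proof (rule measure_eqI)
    fix X assume "X \<in> sets (distr (\<mu> \<Otimes>\<^sub>M \<nu>) borel snd)"
    then have [measurable]: "X \<in> sets \<nu>" and "X \<in> sets borel" by (simp_all add: assms)
    then have X: "X \<subseteq> space \<nu>" by (intro sets.sets_into_space)
    have "emeasure (distr (\<mu> \<Otimes>\<^sub>M \<nu>) borel snd) X = emeasure (\<mu> \<Otimes>\<^sub>M \<nu>) (space \<mu> \<times> X)"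
      using X \<open>X \<in> sets borel\<close> by (subst emeasure_distr)
        (auto simp: assms space_pair_measure intro!: arg_cong[where f="emeasure _"])
    also have "\<dots> = emeasure \<nu> X"
      by (simp add: \<nu>.emeasure_pair_measure_Times \<mu>.emeasure_space_1)
    finally show "emeasure (distr (\<mu> \<Otimes>\<^sub>M \<nu>) borel snd) X = emeasure \<nu> X" .
  qed (simp add: assms)
  show ?thesis
    using 1 2 by (auto simp: couplings_def assms cong: sets_pair_measure_cong)
qed

section \<open>Transport cost and continuity of the energy for \<open>W2\<close>\<close>

lemma measure_of_prob2_props:
  fixes \<mu> :: "'a::euclidean_space prob2"
  shows "prob_space (measure_of_prob2 \<mu>)" "sets (measure_of_prob2 \<mu>) = sets borel"
    "\<exists>x\<^sub>0. (\<integral>\<^sup>+x. ennreal ((dist x x\<^sub>0)\<^sup>2) \<partial>measure_of_prob2 \<mu>) < \<infinity>"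
  using measure_of_prob2[of \<mu>] by (auto simp: P2_def)

text \<open>\<open>W2\<close> passes through \<open>enn2real\<close>, which sends an infinite
  infimum to 0. The extended value is kept apart so that its finiteness can be stated; only then
  does a small \<open>W2\<close> yield a cheap coupling.\<close>

definition transport_cost :: "'a::euclidean_space prob2 \<Rightarrow> 'a prob2 \<Rightarrow> ennreal" where
  "transport_cost \<mu> \<nu> = (INF \<pi>\<in>couplings (measure_of_prob2 \<mu>) (measure_of_prob2 \<nu>).
        \<integral>\<^sup>+ z. ennreal ((dist (fst z) (snd z))\<^sup>2) \<partial>\<pi>)"

lemma W2_eq: "W2 \<mu> \<nu> = sqrt (enn2real (transport_cost \<mu> \<nu>))"
  by (simp add: W2_def transport_cost_def)

lemma transport_cost_finite: "transport_cost \<mu> \<nu> < \<infinity>"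
proof -
  let ?\<mu> = "measure_of_prob2 \<mu>" and ?\<nu> = "measure_of_prob2 \<nu>"
  note \<mu> = measure_of_prob2_props[of \<mu>] and \<nu> = measure_of_prob2_props[of \<nu>]
  note [measurable_cong] = \<mu>(2) \<nu>(2)
  interpret \<mu>: prob_space ?\<mu> by (rule \<mu>)
  interpret \<nu>: prob_space ?\<nu> by (rule \<nu>)
  obtain a b where a: "(\<integral>\<^sup>+x. ennreal ((dist x a)\<^sup>2) \<partial>?\<mu>) < \<infinity>"
    and b: "(\<integral>\<^sup>+x. ennreal ((dist x b)\<^sup>2) \<partial>?\<nu>) < \<infinity>"
    using \<mu>(3) \<nu>(3) by blast
  have "transport_cost \<mu> \<nu> \<le> (\<integral>\<^sup>+z. ennreal ((dist (fst z) (snd z))\<^sup>2) \<partial>(?\<mu> \<Otimes>\<^sub>M ?\<nu>))"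
    unfolding transport_cost_def
    by (rule INF_lower) (rule prod_coupling[OF \<mu>(1) \<nu>(1) \<mu>(2) \<nu>(2)])
  also have "\<dots> \<le> (\<integral>\<^sup>+z. 2 * ennreal ((dist (fst z) a)\<^sup>2) + (4 * ennreal ((dist (snd z) b)\<^sup>2)
      + ennreal (4 * (dist a b)\<^sup>2)) \<partial>(?\<mu> \<Otimes>\<^sub>M ?\<nu>))"
  proof (rule nn_integral_mono)
    fix z :: "'a \<times> 'a"
    \<comment> \<open>The two measures may have different base points; the coefficients 2, 4, 4 come
      from applying \<open>norm_add_power2_le\<close> twice.\<close>
    have "(norm ((fst z - a) + (a - b + (b - snd z))))\<^sup>2
        \<le> 2 * (dist (fst z) a)\<^sup>2 + (4 * (dist (snd z) b)\<^sup>2 + 4 * (dist a b)\<^sup>2)"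
      using norm_add_power2_le[of "fst z - a" "a - b + (b - snd z)"]
        norm_add_power2_le[of "a - b" "b - snd z"]
      by (simp add: dist_norm norm_minus_commute)
    then have "(dist (fst z) (snd z))\<^sup>2
        \<le> 2 * (dist (fst z) a)\<^sup>2 + (4 * (dist (snd z) b)\<^sup>2 + 4 * (dist a b)\<^sup>2)"
      by (simp add: dist_norm)
    then have "ennreal ((dist (fst z) (snd z))\<^sup>2)
        \<le> ennreal (2 * (dist (fst z) a)\<^sup>2 + (4 * (dist (snd z) b)\<^sup>2 + 4 * (dist a b)\<^sup>2))"
      by (rule ennreal_leI)
    then show "ennreal ((dist (fst z) (snd z))\<^sup>2) \<le> 2 * ennreal ((dist (fst z) a)\<^sup>2)
        + (4 * ennreal ((dist (snd z) b)\<^sup>2) + ennreal (4 * (dist a b)\<^sup>2))"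
      by (simp add: ennreal_plus ennreal_mult)
  qed
  also have "\<dots> = 2 * (\<integral>\<^sup>+x. ennreal ((dist x a)\<^sup>2) \<partial>?\<mu>)
      + (4 * (\<integral>\<^sup>+x. ennreal ((dist x b)\<^sup>2) \<partial>?\<nu>) + ennreal (4 * (dist a b)\<^sup>2))"
    by (subst \<nu>.nn_integral_fst[symmetric])
      (auto simp: nn_integral_add nn_integral_cmult \<nu>.emeasure_space_1 \<mu>.emeasure_space_1)
  also have "\<dots> < \<infinity>"
    using a b by (auto simp: ennreal_mult_less_top less_top)
  finally show ?thesis .
qed

text \<open>A strict bound on the infimum already gives a coupling below it, so optimal couplings
  are never invoked; the Lipschitz estimate then lets \<open>e\<close> decrease to
  \<open>W2 \<mu> \<nu>\<close>.\<close>

lemma W2_lessE: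
  assumes "W2 \<mu> \<nu> < e"
  obtains \<pi> where "\<pi> \<in> couplings (measure_of_prob2 \<mu>) (measure_of_prob2 \<nu>)"
    "(\<integral>\<^sup>+ z. ennreal ((dist (fst z) (snd z))\<^sup>2) \<partial>\<pi>) < ennreal (e\<^sup>2)"
proof -
  have "0 \<le> W2 \<mu> \<nu>" by (simp add: W2_eq)
  then have "(W2 \<mu> \<nu>)\<^sup>2 < e\<^sup>2"
    using assms by (intro power_strict_mono) auto
  then have "enn2real (transport_cost \<mu> \<nu>) < e\<^sup>2"
    by (simp add: W2_eq)
  then have "transport_cost \<mu> \<nu> < ennreal (e\<^sup>2)"
    using transport_cost_finite[of \<mu> \<nu>]
    by (metis enn2real_nonneg ennreal_enn2real ennreal_less_iff infinity_ennreal_def)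
  then show thesis
    using that unfolding transport_cost_def INF_less_iff by blast
qed

lemma gaussian_energy_W2_Lipschitz:
  fixes \<mu> \<nu> :: "'a::euclidean_space prob2"
  assumes "r > 0"
  shows "\<bar>gaussian_energy r (measure_of_prob2 \<mu>) - gaussian_energy r (measure_of_prob2 \<nu>)\<bar>
     \<le> 2 / r * W2 \<mu> \<nu>"
proof -
  have "\<bar>gaussian_energy r (measure_of_prob2 \<mu>) - gaussian_energy r (measure_of_prob2 \<nu>)\<bar> * r / 2
      \<le> e" if "W2 \<mu> \<nu> < e" for e
  proof -
    have "0 \<le> W2 \<mu> \<nu>" by (simp add: W2_eq)
    then have "e \<ge> 0" using that by simp
    from W2_lessE[OF that] obtain \<pi>
      where "\<pi> \<in> couplings (measure_of_prob2 \<mu>) (measure_of_prob2 \<nu>)"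
        "(\<integral>\<^sup>+ z. ennreal ((dist (fst z) (snd z))\<^sup>2) \<partial>\<pi>) < ennreal (e\<^sup>2)" .
    then have "\<bar>gaussian_energy r (measure_of_prob2 \<mu>) - gaussian_energy r (measure_of_prob2 \<nu>)\<bar>
        \<le> 2 * e / r"
      using \<open>e \<ge> 0\<close> assms measure_of_prob2_props(1)[of \<mu>]
      by (intro gaussian_energy_coupling_le) auto
    then show ?thesis using assms by (simp add: field_simps)
  qed
  then have "\<bar>gaussian_energy r (measure_of_prob2 \<mu>) - gaussian_energy r (measure_of_prob2 \<nu>)\<bar> * r / 2
      \<le> W2 \<mu> \<nu>"
    by (rule dense_ge) 
  then show ?thesis using assms by (simp add: field_simps)
qed

text \<open>Preimages of open sets are open straight from the definition of
  \<open>open_prob2\<close>, by the Lipschitz estimate; the radius \<open>e * r / 2\<close> inverts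
  the constant \<open>2 / r\<close>.\<close>

lemma borel_measurable_gaussian_energy [measurable]:
  assumes "r > 0"
  shows "(\<lambda>\<mu>::'a::euclidean_space prob2. gaussian_energy r (measure_of_prob2 \<mu>))
    \<in> borel_measurable borel"
proof (rule borel_measurableI)
  fix S :: "real set" assume "open S"
  let ?J = "\<lambda>\<mu>::'a prob2. gaussian_energy r (measure_of_prob2 \<mu>)"
  have "open (?J -` S)"
    unfolding open_prob2_def
  proof
    fix \<mu> assume "\<mu> \<in> ?J -` S"
    then obtain e where e: "e > 0" "\<And>y. dist y (?J \<mu>) < e \<Longrightarrow> y \<in> S"
      using \<open>open S\<close> by (auto simp: open_dist)
    have "?J \<nu> \<in> S" if "W2 \<mu> \<nu> < e * r / 2" for \<nu>
    proof (rule e)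
      have "2 / r * W2 \<mu> \<nu> < 2 / r * (e * r / 2)"
        using that assms by (intro mult_strict_left_mono) auto
      then show "dist (?J \<nu>) (?J \<mu>) < e"
        using gaussian_energy_W2_Lipschitz[OF assms, of \<mu> \<nu>] assms by (auto simp: dist_real_def)
    qed
    then show "\<exists>e>0. \<forall>\<nu>. W2 \<mu> \<nu> < e \<longrightarrow> \<nu> \<in> ?J -` S"
      using e(1) assms by (intro exI[of _ "e * r / 2"]) auto
  qed
  then show "?J -` S \<inter> space borel \<in> sets borel" by simp
qed

section \<open>Representatives of classes and the map \<open>iota\<close>\<close>

lemma cube_L2_cases:
  fixes X :: "'a::euclidean_space cube_L2"
  obtains f where "square_integrable f" "X = abs_cube_L2 f"
proof -
  have "cube_L2_rel (rep_cube_L2 X) (rep_cube_L2 X)" "abs_cube_L2 (rep_cube_L2 X) = X"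
    using Quotient_cube_L2 by (auto simp: Quotient_def)
  then show thesis using that by (auto simp: cube_L2_rel_def)
qed

lemma cube_L2_rel_refl: "cube_L2_rel f f \<longleftrightarrow> square_integrable f"
  by (auto simp: cube_L2_rel_def)

lemma measure_of_prob2_iota:
  assumes "square_integrable f"
  shows "measure_of_prob2 (iota (abs_cube_L2 f)) = distr cube_measure borel f"
  using rel_funD[OF iota.transfer, of f "abs_cube_L2 f"] assms
  by (simp add: cube_L2.pcr_cr_eq cr_cube_L2_def cr_prob2_def cube_L2_rel_refl)

lemma abs_cube_L2_scaleR:
  "square_integrable f \<Longrightarrow> c *\<^sub>R abs_cube_L2 f = abs_cube_L2 (\<lambda>q. c *\<^sub>R f q)"
  by (simp add: scaleR_cube_L2.abs_eq cube_L2_rel_refl)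

lemma abs_cube_L2_arith:
  assumes "square_integrable f" "square_integrable g"
  shows abs_cube_L2_add: "abs_cube_L2 f + abs_cube_L2 g = abs_cube_L2 (\<lambda>q. f q + g q)"
    and abs_cube_L2_diff: "abs_cube_L2 f - abs_cube_L2 g = abs_cube_L2 (\<lambda>q. f q - g q)"
    and abs_cube_L2_inner:
      "abs_cube_L2 f \<bullet> abs_cube_L2 g = (\<integral>q. f q \<bullet> g q \<partial>cube_measure)"
  using assms
  by (auto simp: plus_cube_L2.abs_eq minus_cube_L2.abs_eq inner_cube_L2.abs_eq cube_L2_rel_refl)

lemma norm_abs_cube_L2:
  assumes "square_integrable f"
  shows "ennreal ((norm (abs_cube_L2 f))\<^sup>2) = (\<integral>\<^sup>+q. ennreal ((norm (f q))\<^sup>2) \<partial>cube_measure)"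
proof -
  have "(norm (abs_cube_L2 f))\<^sup>2 = (\<integral>q. (norm (f q))\<^sup>2 \<partial>cube_measure)"
    using assms by (simp add: power2_norm_eq_inner abs_cube_L2_arith)
  then show ?thesis
    using assms by (simp add: nn_integral_eq_integral square_integrable_def)
qed

text \<open>Two maps on the same cube come with a coupling of their laws, the joint law, and its
  cost is the squared L2 distance.\<close>

lemma W2_iota_le: "W2 (iota X) (iota Y) \<le> norm (X - Y)"
proof -
  obtain f where f: "square_integrable f" "X = abs_cube_L2 f" by (rule cube_L2_cases)
  obtain g where g: "square_integrable g" "Y = abs_cube_L2 g" by (rule cube_L2_cases)
  have [measurable]: "f \<in> borel_measurable cube_measure" "g \<in> borel_measurable cube_measure"
    using f g by (auto simp: square_integrable_def)
  let ?\<pi> = "distr cube_measure (borel \<Otimes>\<^sub>M borel) (\<lambda>q. (f q, g q))"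
  have "?\<pi> \<in> couplings (measure_of_prob2 (iota X)) (measure_of_prob2 (iota Y))"
    using f g by (auto simp: couplings_def distr_distr comp_def measure_of_prob2_iota)
  then have "transport_cost (iota X) (iota Y) \<le> (\<integral>\<^sup>+ z. ennreal ((dist (fst z) (snd z))\<^sup>2) \<partial>?\<pi>)"
    unfolding transport_cost_def by (rule INF_lower)
  also have "\<dots> = ennreal ((norm (X - Y))\<^sup>2)"
    using f g by (subst nn_integral_distr)
      (auto simp: abs_cube_L2_arith norm_abs_cube_L2 square_integrable_diff dist_norm)
  finally have "enn2real (transport_cost (iota X) (iota Y)) \<le> (norm (X - Y))\<^sup>2"
    by (intro enn2real_leI) auto
  then show ?thesis
    unfolding W2_eq by (intro real_le_lsqrt) auto
qed

lemma borel_measurable_iota [measurable]: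
  "(iota :: 'a::euclidean_space cube_L2 \<Rightarrow> 'a prob2) \<in> borel_measurable borel"
proof (rule borel_measurableI)
  fix U :: "'a prob2 set" assume U: "open U"
  have "open (iota -` U)"
    unfolding open_dist
  proof
    fix X assume "X \<in> iota -` U"
    then obtain e where "e > 0" and e: "\<And>\<nu>. W2 (iota X) \<nu> < e \<Longrightarrow> \<nu> \<in> U"
      using U by (auto simp: open_prob2_def)
    have "iota Y \<in> U" if "dist Y X < e" for Y
      using that W2_iota_le[of X Y] by (intro e) (simp add: dist_norm norm_minus_commute)
    then show "\<exists>e>0. \<forall>Y. dist Y X < e \<longrightarrow> Y \<in> iota -` U"
      using \<open>e > 0\<close> by auto
  qed
  then show "iota -` U \<inter> space borel \<in> sets borel" by simp
qed

section \<open>Measures of small Gaussian energy are absolutely continuous\<close>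

text \<open>The hyperplane orthogonal to \<open>v\<close> is null in the ambient space, and the
  graph map sends it into the same ambient space, where Lipschitz images of null sets are
  null.\<close>

lemma negligible_dc_hypersurface:
  assumes "dc_hypersurface S"
  shows "negligible S"
proof -
  obtain v f g C D where v: "v \<noteq> 0"
    and f: "C-lipschitz_on {x. orthogonal v x} f" and g: "D-lipschitz_on {x. orthogonal v x} g"
    and S: "S = {x + (f x - g x) *\<^sub>R v | x. orthogonal v x}"
    using assms unfolding dc_hypersurface_def by blast
  let ?H = "{x. orthogonal v x}" and ?F = "\<lambda>x. x + (f x - g x) *\<^sub>R v"
  have "negligible ?H"
    using negligible_hyperplane[of v 0] v by (simp add: orthogonal_def)
  moreover have "norm (?F y - ?F x) \<le> (1 + (C + D) * norm v) * norm (y - x)"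
    if "x \<in> ?H" "y \<in> ?H" for x y
  proof -
    have "?F y - ?F x = (y - x) + ((f y - f x) - (g y - g x)) *\<^sub>R v"
      by (simp add: algebra_simps)
    then have "norm (?F y - ?F x) \<le> norm (y - x) + \<bar>(f y - f x) - (g y - g x)\<bar> * norm v"
      by (metis norm_scaleR norm_triangle_ineq)
    moreover have "\<bar>f y - f x\<bar> \<le> C * norm (y - x)" "\<bar>g y - g x\<bar> \<le> D * norm (y - x)"
      using lipschitz_onD[OF f that(2,1)] lipschitz_onD[OF g that(2,1)]
      by (simp_all add: dist_norm)
    then have "\<bar>(f y - f x) - (g y - g x)\<bar> * norm v \<le> ((C + D) * norm (y - x)) * norm v"
      by (intro mult_right_mono) (auto simp: algebra_simps)
    ultimately show ?thesis by (simp add: algebra_simps)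
  qed
  ultimately have "negligible (?F ` ?H)"
    by (intro negligible_locally_Lipschitz_image) (auto intro!: exI[of _ UNIV])
  also have "?F ` ?H = S" using S by auto
  finally show ?thesis .
qed

text \<open>Mollifying \<open>\<mu>\<close> with the normalised indicator of a ball of radius \<open>r\<close>, the energy bounds the
  squared \<open>L\<^sup>2\<close> norm of the mollified density.\<close>

lemma measure_compact_le_gaussian_energy:
  fixes \<mu> :: "'a::euclidean_space measure"
  assumes "prob_space \<mu>" and sets_\<mu>: "sets \<mu> = sets borel"
    and K: "compact K" and U: "open U" "(\<Union>x\<in>K. ball x r) \<subseteq> U"
    and \<eta>: "emeasure lborel U \<le> ennreal \<eta>" "\<eta> \<ge> 0" and "s > 0" "r > 0"
    and energy: "gaussian_energy r \<mu> \<le> C * r ^ DIM('a)"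
  shows "unit_ball_vol (DIM('a)) * measure \<mu> K
    \<le> s * \<eta> + unit_ball_vol (DIM('a)) * exp 2 * C / s"
proof -
  interpret \<mu>: prob_space \<mu> by fact
  interpret P: pair_sigma_finite lborel \<mu> ..
  interpret PP: pair_prob_space \<mu> \<mu> ..
  interpret T: pair_sigma_finite lborel "\<mu> \<Otimes>\<^sub>M \<mu>" ..
  note [measurable_cong] = sets_\<mu>
  have [measurable]: "K \<in> sets borel" "U \<in> sets borel"
    using K U by (auto intro: borel_compact)
  define \<beta> where "\<beta> = unit_ball_vol (real (DIM('a)))"
  define R where "R = r ^ DIM('a)"
  have pos: "\<beta> > 0" "R > 0" using \<open>r > 0\<close> by (auto simp: \<beta>_def R_def)
  have ball: "emeasure lborel (ball c r) = ennreal (\<beta> * R)" for c :: 'a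
    using \<open>r > 0\<close> by (simp add: emeasure_ball \<beta>_def R_def)
  define b :: "'a \<Rightarrow> 'a \<Rightarrow> ennreal" where "b x y = (if dist x y < r then 1 else 0)" for x y
  have [measurable (raw)]: "(\<lambda>z. b (f z) (g z)) \<in> borel_measurable M"
    if "f \<in> borel_measurable M" "g \<in> borel_measurable M" for f g and M :: "'c measure"
    using that unfolding b_def by measurable
  have [measurable]: "b x \<in> borel_measurable borel" for x
    unfolding b_def by measurable
  have int_b: "(\<integral>\<^sup>+x. b x y \<partial>lborel) = ennreal (\<beta> * R)" for y
  proof -
    have "(\<integral>\<^sup>+x. b x y \<partial>lborel) = (\<integral>\<^sup>+x. indicator (ball y r) x \<partial>lborel)"
      by (intro nn_integral_cong) (auto simp: b_def dist_commute split: split_indicator)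
    then show ?thesis by (simp add: ball)
  qed
  \<comment> \<open>The mass of the ball of radius \<open>r\<close> about \<open>x\<close>, that is,
    the mollified density without its normalising factor \<open>1 / (\<beta> * R)\<close>.\<close>
  define g where "g x = (\<integral>\<^sup>+y. b x y \<partial>\<mu>)" for x
  have [measurable]: "g \<in> borel_measurable borel"
    unfolding g_def b_def by measurable
  have g1: "g x \<le> 1" for x
  proof -
    have "g x \<le> (\<integral>\<^sup>+y. 1 \<partial>\<mu>)"
      unfolding g_def by (intro nn_integral_mono) (auto simp: b_def)
    then show ?thesis by (simp add: \<mu>.emeasure_space_1)
  qed
  have "(\<integral>\<^sup>+x. (g x)\<^sup>2 \<partial>lborel) = (\<integral>\<^sup>+x. (\<integral>\<^sup>+w. b x (fst w) * b x (snd w) \<partial>(\<mu> \<Otimes>\<^sub>M \<mu>)) \<partial>lborel)"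
    by (subst \<mu>.nn_integral_fst[symmetric])
      (auto simp: g_def power2_eq_square nn_integral_cmult nn_integral_multc)
  also have "\<dots> = (\<integral>\<^sup>+w. (\<integral>\<^sup>+x. b x (fst w) * b x (snd w) \<partial>lborel) \<partial>(\<mu> \<Otimes>\<^sub>M \<mu>))"
    unfolding b_def by (rule T.Fubini'[symmetric]) measurable
  also have "\<dots> \<le> (\<integral>\<^sup>+w. ennreal (\<beta> * R * exp 2 * exp (- (dist (fst w) (snd w))\<^sup>2 / (2 * r\<^sup>2))) \<partial>(\<mu> \<Otimes>\<^sub>M \<mu>))"
  proof (rule nn_integral_mono)
    fix w :: "'a \<times> 'a"
    show "(\<integral>\<^sup>+x. b x (fst w) * b x (snd w) \<partial>lborel)
        \<le> ennreal (\<beta> * R * exp 2 * exp (- (dist (fst w) (snd w))\<^sup>2 / (2 * r\<^sup>2)))"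
    \<comment> \<open>Two balls of radius \<open>r\<close> meet only if their centres are closer
      than \<open>2 * r\<close>; there the kernel is at least exp(-2), which is the origin of the
      factor \<open>exp 2\<close>.\<close>
    proof (cases "dist (fst w) (snd w) < 2 * r")
      case True
      then have "(dist (fst w) (snd w))\<^sup>2 \<le> (2 * r)\<^sup>2"
        by (intro power_mono) auto
      then have "(dist (fst w) (snd w))\<^sup>2 / (2 * r\<^sup>2) \<le> 2"
        using \<open>r > 0\<close> by (simp add: field_simps)
      then have 1: "1 \<le> exp 2 * exp (- (dist (fst w) (snd w))\<^sup>2 / (2 * r\<^sup>2))"
        by (simp flip: exp_add)
      have "(\<integral>\<^sup>+x. b x (fst w) * b x (snd w) \<partial>lborel) \<le> (\<integral>\<^sup>+x. b x (fst w) \<partial>lborel)"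
        by (intro nn_integral_mono) (auto simp: b_def)
      also have "\<dots> \<le> ennreal (\<beta> * R * exp 2 * exp (- (dist (fst w) (snd w))\<^sup>2 / (2 * r\<^sup>2)))"
        unfolding int_b using mult_left_mono[OF 1, of "\<beta> * R"] pos
        by (intro ennreal_leI) (simp add: mult.assoc)
      finally show ?thesis .
    next
      case False
      have "\<not> (dist x (fst w) < r \<and> dist x (snd w) < r)" for x
        using False dist_triangle3[of "fst w" "snd w" x] by auto
      then have "(\<lambda>x. b x (fst w) * b x (snd w)) = (\<lambda>_. 0)"
        by (auto simp: b_def)
      then show ?thesis by simp
    qed
  qed
  also have "\<dots> = ennreal (\<integral>w. \<beta> * R * exp 2 * exp (- (dist (fst w) (snd w))\<^sup>2 / (2 * r\<^sup>2)) \<partial>(\<mu> \<Otimes>\<^sub>M \<mu>))"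
    using pos by (intro nn_integral_eq_integral PP.integrable_const_bound[where B="\<beta> * R * exp 2"]) auto
  also have "\<dots> = ennreal (\<beta> * R * exp 2 * gaussian_energy r \<mu>)"
    unfolding gaussian_energy_def by simp
  also have "\<dots> \<le> ennreal (\<beta> * R * exp 2 * (C * R))"
    using energy pos by (intro ennreal_leI mult_left_mono) (auto simp: R_def)
  finally have g2: "(\<integral>\<^sup>+x. (g x)\<^sup>2 \<partial>lborel) \<le> ennreal (\<beta> * R * exp 2 * (C * R))" .
  have "0 \<le> C * R"
    using gaussian_energy_nonneg[of r \<mu>] energy unfolding R_def by linarith
  then have "C \<ge> 0" using pos by (simp add: zero_le_mult_iff)
  \<comment> \<open>The level at which \<open>g\<close> is cut. Scaling it with \<open>R\<close>
    makes every power of \<open>r\<close> cancel in the final estimate.\<close>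
  define t where "t = s * R"
  have "t > 0" using pos \<open>s > 0\<close> by (simp add: t_def)
  have "ennreal (\<beta> * R) * emeasure \<mu> K = (\<integral>\<^sup>+y. indicator K y * (\<integral>\<^sup>+x. b x y \<partial>lborel) \<partial>\<mu>)"
    by (simp add: int_b nn_integral_multc mult.commute)
  also have "\<dots> = (\<integral>\<^sup>+y. (\<integral>\<^sup>+x. indicator K y * b x y \<partial>lborel) \<partial>\<mu>)"
    unfolding b_def by (intro nn_integral_cong nn_integral_cmult[symmetric]) measurable
  \<comment> \<open>A ball of radius \<open>r\<close> about a point of \<open>K\<close> stays inside
    \<open>U\<close>, so the smeared mass of \<open>K\<close> is caught by \<open>U\<close>.\<close>
  also have "\<dots> \<le> (\<integral>\<^sup>+y. (\<integral>\<^sup>+x. indicator U x * b x y \<partial>lborel) \<partial>\<mu>)"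
  proof (intro nn_integral_mono)
    fix x y
    show "indicator K y * b x y \<le> indicator U x * b x y"
      using U(2) by (auto simp: b_def dist_commute subset_iff split: split_indicator)
  qed
  also have "\<dots> = (\<integral>\<^sup>+x. (\<integral>\<^sup>+y. indicator U x * b x y \<partial>\<mu>) \<partial>lborel)"
    unfolding b_def by (rule P.Fubini') measurable
  also have "\<dots> = (\<integral>\<^sup>+x. indicator U x * g x \<partial>lborel)"
    by (simp add: g_def nn_integral_cmult)
  also have "\<dots> \<le> (\<integral>\<^sup>+x. ennreal t * indicator U x + ennreal (1 / t) * (g x)\<^sup>2 \<partial>lborel)"
  proof (intro nn_integral_mono)
    fix x
    obtain a where a: "g x = ennreal a" "a \<ge> 0"
      using g1[of x] by (cases "g x") (auto simp: top_unique)
    \<comment> \<open>Where the density is at most \<open>t\<close> it is paid for by the volume of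
      \<open>U\<close>, elsewhere by its square as in Chebyshev's inequality.\<close>
    have "a \<le> t + 1 / t * a\<^sup>2"
    proof (cases "a \<le> t")
      case False
      then have "a * t \<le> a * a" using a by (intro mult_left_mono) auto
      then have "a \<le> 1 / t * a\<^sup>2" using \<open>t > 0\<close> by (simp add: field_simps power2_eq_square)
      then show ?thesis using \<open>t > 0\<close> by simp
    qed (use \<open>t > 0\<close> in \<open>simp add: add_increasing2\<close>)
    then have "ennreal a \<le> ennreal t + ennreal (1 / t) * (ennreal a)\<^sup>2"
      using a \<open>t > 0\<close> by (simp add: ennreal_power flip: ennreal_mult ennreal_plus)
    then show "indicator U x * g x \<le> ennreal t * indicator U x + ennreal (1 / t) * (g x)\<^sup>2"
      by (auto simp: a split: split_indicator)
  qed
  also have "\<dots> = ennreal t * emeasure lborel U + ennreal (1 / t) * (\<integral>\<^sup>+x. (g x)\<^sup>2 \<partial>lborel)"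
    by (simp add: nn_integral_add nn_integral_cmult)
  also have "\<dots> \<le> ennreal t * ennreal \<eta> + ennreal (1 / t) * ennreal (\<beta> * R * exp 2 * (C * R))"
    by (intro add_mono mult_left_mono g2 \<eta>) auto
  also have "\<dots> = ennreal (t * \<eta> + 1 / t * (\<beta> * R * exp 2 * (C * R)))"
    using \<open>t > 0\<close> \<eta> pos \<open>C \<ge> 0\<close> by (simp flip: ennreal_mult ennreal_plus)
  finally have "ennreal (\<beta> * R * measure \<mu> K)
      \<le> ennreal (t * \<eta> + 1 / t * (\<beta> * R * exp 2 * (C * R)))"
    using pos by (simp add: \<mu>.emeasure_eq_measure ennreal_mult)
  then have "\<beta> * R * measure \<mu> K \<le> t * \<eta> + 1 / t * (\<beta> * R * exp 2 * (C * R))"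
    using \<open>t > 0\<close> \<eta> pos \<open>C \<ge> 0\<close> by (subst (asm) ennreal_le_iff) auto
  also have "\<dots> = R * (s * \<eta> + \<beta> * exp 2 * C / s)"
    using pos \<open>s > 0\<close> by (simp add: t_def field_simps)
  finally have "R * (\<beta> * measure \<mu> K) \<le> R * (s * \<eta> + \<beta> * exp 2 * C / s)"
    by (simp add: mult_ac)
  then show ?thesis
    using pos by (simp add: \<beta>_def)
qed

text \<open>Inner regularity reduces a null set to a compact subset, because compactness gives a
  uniform margin inside an open superset of small volume. One good radius below that margin is
  enough, so a bound for infinitely many \<open>k\<close> suffices. Afterwards the volume
  \<open>\<eta>\<close> tends to 0 and then the parameter \<open>s\<close> to infinity.\<close>

lemma absolutely_continuous_of_gaussian_energy:
  fixes \<mu> :: "'a::euclidean_space measure"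
  assumes "prob_space \<mu>" and sets_\<mu>: "sets \<mu> = sets borel"
    and r: "\<And>k. r k > 0" "r \<longlonglongrightarrow> 0"
    and energy: "\<exists>\<^sub>F k in sequentially. gaussian_energy (r k) \<mu> \<le> C * r k ^ DIM('a)"
  shows "absolutely_continuous lborel \<mu>"
  unfolding absolutely_continuous_def
proof
  fix N assume N: "N \<in> null_sets (lborel :: 'a measure)"
  interpret \<mu>: prob_space \<mu> by fact
  define \<beta> where "\<beta> = unit_ball_vol (real (DIM('a)))"
  have "\<beta> > 0" by (simp add: \<beta>_def)
  have *: "measure \<mu> K = 0" if K: "compact K" "K \<subseteq> N" for K
  proof -
    have le: "\<beta> * measure \<mu> K \<le> s * \<eta> + \<beta> * exp 2 * C / s" if "s > 0" "\<eta> > 0" for s \<eta>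
    proof -
      have "N \<in> sets borel" using N by auto
      from outer_regular_lborel[OF this \<open>\<eta> > 0\<close>]
      obtain U where U: "open U" "N \<subseteq> U" "emeasure lborel (U - N) < ennreal \<eta>" .
      then have U': "emeasure lborel U \<le> ennreal \<eta>"
        using N by (simp add: emeasure_Diff_null_set)
      obtain \<delta> where \<delta>: "\<delta> > 0" "(\<Union>x\<in>K. ball x \<delta>) \<subseteq> U"
        using compact_subset_open_imp_ball_epsilon_subset[of K U] K U by blast
      have "\<forall>\<^sub>F k in sequentially. r k < \<delta>"
        using r \<delta> by (simp add: order_tendstoD)
      then obtain k where k: "r k < \<delta>" "gaussian_energy (r k) \<mu> \<le> C * r k ^ DIM('a)"
        using frequently_ex[OF frequently_eventually_frequently[OF energy]] by blast
      have "(\<Union>x\<in>K. ball x (r k)) \<subseteq> U"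
        using \<delta> k(1) by fastforce
      then show ?thesis
        unfolding \<beta>_def using assms(1,2) K U U' that r k
        by (intro measure_compact_le_gaussian_energy) auto
    qed
    have le2: "measure \<mu> K \<le> exp 2 * C / s" if "s > 0" for s
    proof -
      have "\<beta> * measure \<mu> K \<le> \<beta> * (exp 2 * C / s)"
      proof (rule field_le_epsilon)
        fix e :: real assume "e > 0"
        \<comment> \<open>With the volume bound \<open>e / s\<close> the first term
          \<open>s * \<eta>\<close> becomes exactly \<open>e\<close>.\<close>
        then show "\<beta> * measure \<mu> K \<le> \<beta> * (exp 2 * C / s) + e"
          using le[of s "e / s"] \<open>s > 0\<close> by (simp add: mult_ac)
      qed
      then show ?thesis using \<open>\<beta> > 0\<close> by (simp only: mult_le_cancel_left_pos)
    qed
    have "measure \<mu> K \<le> 0"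
    proof (rule field_le_epsilon)
      fix e :: real assume "e > 0"
      \<comment> \<open>This \<open>s\<close> is large enough to push the quotient below
        \<open>e\<close>; the absolute value and the \<open>+ 1\<close> keep it positive whatever
        the sign of \<open>C\<close>.\<close>
      have "measure \<mu> K \<le> exp 2 * C / ((exp 2 * \<bar>C\<bar> + 1) / e)"
        using \<open>e > 0\<close> by (intro le2) (auto intro!: divide_pos_pos add_nonneg_pos)
      also have "\<dots> \<le> exp 2 * \<bar>C\<bar> / ((exp 2 * \<bar>C\<bar> + 1) / e)"
        using \<open>e > 0\<close> by (intro divide_right_mono mult_left_mono) auto
      also have "\<dots> \<le> e"
        using \<open>e > 0\<close> by (simp add: field_simps add_pos_nonneg)
      finally show "measure \<mu> K \<le> 0 + e" by simp
    qed
    then show ?thesis by (simp add: measure_le_0_iff)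
  qed
  have "emeasure \<mu> N = (SUP K \<in> {K. K \<subseteq> N \<and> compact K}. emeasure \<mu> K)"
    using N by (intro inner_regular sets_\<mu>) auto
  also have "\<dots> = 0"
    using * by (auto simp: \<mu>.emeasure_eq_measure SUP_eq_iff intro!: antisym SUP_least)
  finally show "N \<in> null_sets \<mu>"
    using N by (auto simp: null_sets_def sets_\<mu>)
qed

text \<open>A set outside the Borel sigma-algebra has \<open>emeasure\<close> 0 by convention, so
  the case split takes the place of a proof that \<open>S\<close> is Borel.\<close>

lemma emeasure_dc_hypersurface_eq_0:
  fixes \<mu> :: "'a::euclidean_space measure"
  assumes "absolutely_continuous lborel \<mu>" "sets \<mu> = sets borel" "dc_hypersurface S"
  shows "emeasure \<mu> S = 0"
proof (cases "S \<in> sets borel")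
  case True
  then have "S \<in> null_sets lborel"
    using negligible_dc_hypersurface[OF assms(3)]
    by (simp add: negligible_iff_null_sets null_sets_completion_iff)
  then show ?thesis
    using assms(1) by (auto simp: absolutely_continuous_def)
qed (simp add: emeasure_notin_sets assms)

section \<open>Gaussian laws\<close>

lemma normal_law_eq_distr_std_normal:
  assumes "s > 0"
  shows "normal_law 0 s = distr std_normal_distribution borel (\<lambda>x. sqrt s * x)"
proof -
  interpret N: prob_space std_normal_distribution
    by (rule prob_space_normal_density) simp
  have "distributed std_normal_distribution lborel (\<lambda>x. x) std_normal_density"
    by (auto simp: distributed_def distr_id2)
  from N.normal_density_affine[OF this, of "sqrt s" 0] assms
  have "distr std_normal_distribution lborel (\<lambda>x. sqrt s * x)
      = density lborel (normal_density 0 (sqrt s))"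
    by (simp add: distributed_def)
  moreover have "distr std_normal_distribution lborel (\<lambda>x. sqrt s * x) =
      distr std_normal_distribution borel (\<lambda>x. sqrt s * x)"
    by (rule distr_cong) auto
  ultimately show ?thesis using assms by (simp add: normal_law_def)
qed

lemma real_distribution_normal_law:
  assumes "s \<ge> 0"
  shows "real_distribution (normal_law m s)"
proof (intro real_distribution.intro real_distribution_axioms.intro)
  show "prob_space (normal_law m s)"
    using assms by (auto simp: normal_law_def intro: prob_space_return prob_space_normal_density)
qed (auto simp: normal_law_def)

text \<open>The formula includes the Dirac law at \<open>s = 0\<close>, so passing to the limit in
  the variance needs no case distinction.\<close>

lemma char_normal_law:
  assumes "s \<ge> 0"
  shows "char (normal_law 0 s) t = complex_of_real (exp (- (s * t\<^sup>2) / 2))"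
proof (cases "s = 0")
  case True
  then show ?thesis by (simp add: normal_law_def char_def integral_return)
next
  case False
  then have "s > 0" using assms by simp
  then have "char (normal_law 0 s) t = char std_normal_distribution (t * sqrt s)"
    by (simp add: normal_law_eq_distr_std_normal char_def integral_distr mult.assoc)
  then show ?thesis
    using assms by (simp add: char_std_normal_distribution power_mult_distrib mult.commute)
qed

lemma nn_integral_normal_law_square_finite:
  assumes "s \<ge> 0"
  shows "(\<integral>\<^sup>+x. ennreal (x\<^sup>2) \<partial>normal_law 0 s) < \<infinity>"
proof (cases "s = 0")
  case True
  then show ?thesis by (simp add: normal_law_def nn_integral_return)
next
  case False
  then have "s > 0" using assms by simp
  have "integrable lborel (\<lambda>x. normal_density 0 (sqrt s) x * x\<^sup>2)"
    using integrable_normal_moment[of "sqrt s" 0 2] \<open>s > 0\<close> by simp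
  then have "integrable (normal_law 0 s) (\<lambda>x. x\<^sup>2)"
    using \<open>s > 0\<close> by (simp add: normal_law_def integrable_density)
  then show ?thesis
    by (simp add: nn_integral_eq_integral)
qed

text \<open>The product of the standard density and the Gaussian factor is \<open>\<sigma>\<close>
  times the normal density of variance \<open>1 / (1 + c\<^sup>2)\<close>, and the latter has
  integral 1.\<close>

lemma integral_std_normal_gaussian:
  "(\<integral>x. exp (- (c\<^sup>2 * x\<^sup>2) / 2) \<partial>std_normal_distribution) = 1 / sqrt (1 + c\<^sup>2)" (is ?int)
  and integrable_std_normal_gaussian:
  "integrable std_normal_distribution (\<lambda>x. exp (- (c\<^sup>2 * x\<^sup>2) / 2))"
proof -
  interpret N: prob_space std_normal_distribution
    by (rule prob_space_normal_density) simp
  show "integrable std_normal_distribution (\<lambda>x. exp (- (c\<^sup>2 * x\<^sup>2) / 2))"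
    by (rule N.integrable_const_bound[where B=1]) auto
  have pos: "1 + c\<^sup>2 > 0" by (simp add: add_pos_nonneg)
  define \<sigma> where "\<sigma> = 1 / sqrt (1 + c\<^sup>2)"
  have \<sigma>: "\<sigma> > 0" "\<sigma>\<^sup>2 = 1 / (1 + c\<^sup>2)"
    using pos by (auto simp: \<sigma>_def power_divide)
  have "std_normal_density x * exp (- (c\<^sup>2 * x\<^sup>2) / 2) = \<sigma> * normal_density 0 \<sigma> x" for x
  proof -
    have "exp (- (x\<^sup>2) / 2) * exp (- (c\<^sup>2 * x\<^sup>2) / 2) = exp (- x\<^sup>2 / (2 * \<sigma>\<^sup>2))"
      unfolding \<sigma>(2) using pos by (simp flip: exp_add add: field_simps)
    then show ?thesis
      using \<sigma>(1) by (simp add: normal_density_def real_sqrt_mult)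
  qed
  then have "(\<integral>x. std_normal_density x * exp (- (c\<^sup>2 * x\<^sup>2) / 2) \<partial>lborel) = \<sigma>"
    using \<sigma>(1) by simp
  then show ?int
    by (simp add: integral_density \<sigma>_def)
qed

text \<open>The Gaussian kernel is the characteristic function of an independent standard normal vector,
  so Fubini's theorem turns its expectation into an average of characteristic functions of \<open>Y\<close>.\<close>

lemma (in prob_space) expectation_gaussian_kernel_le:
  fixes Y :: "'a \<Rightarrow> 'b::euclidean_space"
  assumes Y [measurable]: "Y \<in> borel_measurable M" and "a > 0" "r > 0"
    and char: "\<And>v. (CLINT \<omega>|M. iexp (v \<bullet> Y \<omega>)) = complex_of_real (exp (- V v / 2))"
    and V: "\<And>v. a\<^sup>2 * (norm v)\<^sup>2 \<le> V v"
  shows "expectation (\<lambda>\<omega>. exp (- (norm (Y \<omega>))\<^sup>2 / (2 * r\<^sup>2))) \<le> (r / a) ^ DIM('b)"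
proof -
  define \<Gamma> :: "('b \<Rightarrow> real) measure" where "\<Gamma> = PiM Basis (\<lambda>_. std_normal_distribution)"
  interpret N: prob_space std_normal_distribution by (rule prob_space_normal_density) simp
  interpret PN: product_prob_space "\<lambda>_::'b. std_normal_distribution" Basis ..
  interpret \<Gamma>: prob_space \<Gamma> unfolding \<Gamma>_def by (rule PN.prob_space_axioms)
  interpret P: pair_prob_space M \<Gamma> ..
  define Z :: "('b \<Rightarrow> real) \<Rightarrow> 'b" where "Z z = (\<Sum>b\<in>Basis. z b *\<^sub>R b)" for z
  have [measurable]: "Z \<in> borel_measurable \<Gamma>"
  proof -
    have "(\<lambda>z. z b) \<in> borel_measurable \<Gamma>" if "b \<in> Basis" for b
      using measurable_component_singleton[OF that, of "\<lambda>_. std_normal_distribution"]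
      unfolding \<Gamma>_def by (simp cong: measurable_cong_sets)
    then show ?thesis
      unfolding Z_def by (intro borel_measurable_sum borel_measurable_scaleR) auto
  qed
  have Z_inner: "Z z \<bullet> y = (\<Sum>b\<in>Basis. z b * (y \<bullet> b))" for z y
    by (simp add: Z_def inner_sum_left inner_commute[of y])
  have Z_norm: "(norm (Z z))\<^sup>2 = (\<Sum>b\<in>Basis. (z b)\<^sup>2)" for z
  proof -
    have "Z z \<bullet> b = z b" if "b \<in> Basis" for b
      using that by (simp add: Z_def)
    then show ?thesis
      using Z_inner[of z "Z z"] by (simp add: power2_norm_eq_inner flip: power2_eq_square)
  qed
  have kernel: "complex_of_real (exp (- (norm y)\<^sup>2 / (2 * r\<^sup>2))) =
      (CLINT z|\<Gamma>. iexp ((Z z \<bullet> y) / r))" for y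
  proof -
    have "(CLINT z|\<Gamma>. iexp ((Z z \<bullet> y) / r)) =
        (CLINT z|\<Gamma>. (\<Prod>b\<in>Basis. iexp ((y \<bullet> b) / r * z b)))"
      by (simp add: Z_inner sum_divide_distrib sum_distrib_left flip: exp_sum)
        (simp add: mult_ac)
    also have "\<dots> = (\<Prod>b\<in>Basis. char std_normal_distribution ((y \<bullet> b) / r))"
      unfolding \<Gamma>_def char_def
      by (rule PN.product_integral_prod)
        (auto intro!: N.integrable_const_bound[where B=1])
    also have "\<dots> = complex_of_real (exp (\<Sum>b\<in>Basis. - ((y \<bullet> b) / r)\<^sup>2 / 2))"
      by (simp add: char_std_normal_distribution exp_sum)
    also have "(\<Sum>b\<in>Basis. - ((y \<bullet> b) / r)\<^sup>2 / 2) = - (\<Sum>b\<in>Basis. (y \<bullet> b)\<^sup>2) / (2 * r\<^sup>2)"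
      by (simp add: power_divide sum_negf mult.commute flip: sum_divide_distrib)
    also have "(\<Sum>b\<in>Basis. (y \<bullet> b)\<^sup>2) = (norm y)\<^sup>2"
      by (simp add: power2_norm_eq_inner euclidean_inner[of y y] flip: power2_eq_square)
    finally show ?thesis by simp
  qed
  have "complex_of_real (expectation (\<lambda>\<omega>. exp (- (norm (Y \<omega>))\<^sup>2 / (2 * r\<^sup>2)))) =
      (CLINT \<omega>|M. (CLINT z|\<Gamma>. iexp ((Z z \<bullet> Y \<omega>) / r)))"
    by (simp only: kernel[symmetric] integral_complex_of_real)
  also have "\<dots> = (CLINT z|\<Gamma>. (CLINT \<omega>|M. iexp ((Z z \<bullet> Y \<omega>) / r)))"
    by (rule P.Fubini_integral[symmetric])
      (auto intro!: P.integrable_const_bound[where B=1] simp: case_prod_beta')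
  also have "\<dots> = (CLINT z|\<Gamma>. complex_of_real (exp (- V (Z z /\<^sub>R r) / 2)))"
  proof (rule Bochner_Integration.integral_cong)
    fix z
    show "(CLINT \<omega>|M. iexp ((Z z \<bullet> Y \<omega>) / r)) = complex_of_real (exp (- V (Z z /\<^sub>R r) / 2))"
    proof -
      have "(Z z \<bullet> y) / r = (Z z /\<^sub>R r) \<bullet> y" for y
        by (simp add: divide_inverse)
      then show ?thesis by (simp only: char)
    qed
  qed simp
  finally have eq: "expectation (\<lambda>\<omega>. exp (- (norm (Y \<omega>))\<^sup>2 / (2 * r\<^sup>2))) =
      (\<integral>z. exp (- V (Z z /\<^sub>R r) / 2) \<partial>\<Gamma>)"
    by (simp only: integral_complex_of_real of_real_eq_iff)
  define c where "c = a / r"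
  have "c > 0" using \<open>a > 0\<close> \<open>r > 0\<close> by (simp add: c_def)
  \<comment> \<open>Replacing \<open>V\<close> by its isotropic lower bound makes the integrand
    factor over the coordinates, and each factor has a known integral.\<close>
  have le: "exp (- V (Z z /\<^sub>R r) / 2) \<le> (\<Prod>b\<in>Basis. exp (- (c\<^sup>2 * (z b)\<^sup>2) / 2))" for z
  proof -
    have "(\<Sum>b\<in>Basis. - (c\<^sup>2 * (z b)\<^sup>2) / 2) = - (a\<^sup>2 * (norm (Z z /\<^sub>R r))\<^sup>2) / 2"
      by (simp add: c_def power_mult_distrib power_divide Z_norm sum_distrib_left sum_negf
          field_simps flip: sum_divide_distrib)
    then show ?thesis
      using V[of "Z z /\<^sub>R r"] by (simp flip: exp_sum)
  qed
  have int: "integrable \<Gamma> (\<lambda>z. (\<Prod>b\<in>Basis. exp (- (c\<^sup>2 * (z b)\<^sup>2) / 2)))"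
    unfolding \<Gamma>_def
    by (intro PN.product_integrable_prod integrable_std_normal_gaussian finite_Basis)
  have "(\<integral>z. exp (- V (Z z /\<^sub>R r) / 2) \<partial>\<Gamma>) \<le> (\<integral>z. (\<Prod>b\<in>Basis. exp (- (c\<^sup>2 * (z b)\<^sup>2) / 2)) \<partial>\<Gamma>)"
    by (rule integral_mono'[OF int]) (use le in \<open>auto intro!: prod_nonneg\<close>)
  also have "\<dots> = (1 / sqrt (1 + c\<^sup>2)) ^ DIM('b)"
    unfolding \<Gamma>_def
    by (subst PN.product_integral_prod[OF finite_Basis integrable_std_normal_gaussian])
      (simp only: integral_std_normal_gaussian prod_constant)
  \<comment> \<open>Dropping the 1 is harmless, since \<open>c = a / r\<close> grows as
    \<open>r\<close> shrinks, and it leaves the pure power of \<open>r\<close> that the criterion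
    for absolute continuity asks for.\<close>
  also have "\<dots> \<le> (1 / c) ^ DIM('b)"
  proof (intro power_mono divide_left_mono)
    show "c \<le> sqrt (1 + c\<^sup>2)" by (rule real_le_rsqrt) simp
  qed (use \<open>c > 0\<close> in \<open>auto simp: add_pos_nonneg\<close>)
  finally show ?thesis
    unfolding eq c_def by simp
qed

section \<open>Totality of the Walsh system\<close>

interpretation cube: prob_space cube_measure
  by (rule prob_space_cube_measure)

lemma space_cube_measure: "space cube_measure = {1..} \<rightarrow>\<^sub>E {-1, 1}"
  by (simp add: cube_measure_def space_PiM space_uniform_count_measure)

lemma cube_component_cases:
  assumes "q \<in> space cube_measure" "i \<ge> 1"
  shows "q i = -1 \<or> q i = 1"
  using assms by (auto simp: space_cube_measure PiE_iff)

lemma borel_measurable_cube_component: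
  assumes "i \<ge> 1"
  shows "(\<lambda>q. q i) \<in> borel_measurable cube_measure"
proof -
  have "(\<lambda>q. q i) \<in> measurable cube_measure (uniform_count_measure {-1, 1})"
    unfolding cube_measure_def using assms by (intro measurable_component_singleton) auto
  moreover have "(\<lambda>x. x) \<in> borel_measurable (uniform_count_measure {-1, 1 :: real})"
    by (simp cong: measurable_cong_sets)
  ultimately show ?thesis
    by (rule measurable_compose[where g="\<lambda>x. x"])
qed

lemma emeasure_cube_cylinder:
  assumes "\<And>i. i \<in> {1..n} \<Longrightarrow> a i = -1 \<or> a i = 1"
  shows "emeasure cube_measure {q \<in> space cube_measure. \<forall>i\<in>{1..n}. q i = a i} = ennreal ((1 / 2) ^ n)"
proof -
  interpret U: prob_space "uniform_count_measure {-1, 1 :: real}"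
    by (rule prob_space_uniform_count_measure) auto
  interpret product_prob_space "\<lambda>_. uniform_count_measure {-1, 1 :: real}" "{1 :: nat..}" ..
  have "emeasure cube_measure {q \<in> space cube_measure. \<forall>i\<in>{1..n}. q i \<in> {a i}}
      = (\<Prod>i\<in>{1..n}. emeasure (uniform_count_measure {-1, 1 :: real}) {a i})"
    unfolding cube_measure_def using assms
    by (intro emeasure_PiM_Collect) (auto simp: sets_uniform_count_measure)
  also have "\<dots> = (\<Prod>i\<in>{1..n}. ennreal (1 / 2))"
    using assms by (intro prod.cong) (auto simp: emeasure_uniform_count_measure)
  also have "\<dots> = ennreal ((1 / 2) ^ n)"
    unfolding prod_constant by (subst ennreal_power) auto
  finally show ?thesis by simp
qed

section \<open>Walsh functions as elements of the Hilbert space\<close>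

lemma abs_walsh:
  assumes "I \<in> walsh_index" "q \<in> space cube_measure"
  shows "\<bar>walsh I q\<bar> = 1"
proof -
  have "\<bar>q i\<bar> = 1" if "i \<in> I" for i
    using cube_component_cases[OF assms(2), of i] that assms(1) by (force simp: walsh_index_def)
  then show ?thesis by (simp add: walsh_def abs_prod)
qed

lemma borel_measurable_walsh [measurable]:
  assumes "I \<in> walsh_index"
  shows "walsh I \<in> borel_measurable cube_measure"
  unfolding walsh_def using assms
  by (intro borel_measurable_prod borel_measurable_cube_component) (auto simp: walsh_index_def)

lemma square_integrable_bounded:
  fixes f :: "(nat \<Rightarrow> real) \<Rightarrow> 'a::euclidean_space"
  assumes [measurable]: "f \<in> borel_measurable cube_measure"
    and "\<And>q. q \<in> space cube_measure \<Longrightarrow> norm (f q) \<le> C"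
  shows "square_integrable f"
  unfolding square_integrable_def
  using assms(2) by (auto intro!: cube.integrable_const_bound[where B="C\<^sup>2"] AE_I2 power_mono)

lemma square_integrable_walsh:
  assumes "I \<in> walsh_index"
  shows "square_integrable (\<lambda>q. walsh I q *\<^sub>R x)"
  using assms by (intro square_integrable_bounded[where C="norm x"]) (auto simp: abs_walsh)

lemma norm_walsh:
  assumes "I \<in> walsh_index"
  shows "norm (abs_cube_L2 (\<lambda>q. walsh I q *\<^sub>R x)) = norm x"
proof -
  have "ennreal ((norm (abs_cube_L2 (\<lambda>q. walsh I q *\<^sub>R x)))\<^sup>2)
      = (\<integral>\<^sup>+q. ennreal ((norm x)\<^sup>2) \<partial>cube_measure)"
    unfolding norm_abs_cube_L2[OF square_integrable_walsh[OF assms]]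
    by (intro nn_integral_cong) (simp add: abs_walsh[OF assms])
  then show ?thesis by (simp add: cube.emeasure_space_1)
qed

lemma abs_cube_L2_cong:
  assumes "square_integrable f" "square_integrable g"
    and "\<And>q. q \<in> space cube_measure \<Longrightarrow> f q = g q"
  shows "abs_cube_L2 f = abs_cube_L2 g"
proof -
  have "cube_L2_rel f g"
    using assms by (auto simp: cube_L2_rel_def)
  then show ?thesis
    using Quotient_cube_L2 by (auto simp: Quotient_def)
qed

lemma abs_cube_L2_zero: "abs_cube_L2 (\<lambda>_. 0) = 0"
  by (simp add: zero_cube_L2_def)

lemma square_integrable_sum:
  assumes "\<And>i. i \<in> F \<Longrightarrow> square_integrable (f i)"
  shows "square_integrable (\<lambda>q. \<Sum>i\<in>F. f i q)"
  using assms
  by (induction F rule: infinite_finite_induct) (auto intro: square_integrable_0 square_integrable_add)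

lemma abs_cube_L2_sum:
  assumes "\<And>i. i \<in> F \<Longrightarrow> square_integrable (f i)"
  shows "(\<Sum>i\<in>F. abs_cube_L2 (f i)) = abs_cube_L2 (\<lambda>q. \<Sum>i\<in>F. f i q)"
  using assms
  by (induction F rule: infinite_finite_induct)
    (auto simp: abs_cube_L2_zero abs_cube_L2_arith square_integrable_sum)

text \<open>The constant 2 is the one in the approximation of a measurable map by simple functions
  used below; it gives the dominating function \<open>(3 * norm (f q))\<^sup>2\<close>.\<close>

lemma abs_cube_L2_tendsto:
  fixes f :: "(nat \<Rightarrow> real) \<Rightarrow> 'a::euclidean_space"
  assumes s: "\<And>n. square_integrable (s n)" and f: "square_integrable f"
    and lim: "\<And>q. q \<in> space cube_measure \<Longrightarrow> (\<lambda>n. s n q) \<longlonglongrightarrow> f q"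
    and bound: "\<And>n q. q \<in> space cube_measure \<Longrightarrow> norm (s n q) \<le> 2 * norm (f q)"
  shows "(\<lambda>n. abs_cube_L2 (s n)) \<longlonglongrightarrow> abs_cube_L2 f"
proof -
  have [measurable]: "f \<in> borel_measurable cube_measure" "s n \<in> borel_measurable cube_measure" for n
    using s f by (auto simp: square_integrable_def)
  have "(\<lambda>n. \<integral>q. (norm (s n q - f q))\<^sup>2 \<partial>cube_measure) \<longlonglongrightarrow> (\<integral>q. 0 \<partial>cube_measure)"
  proof (rule integral_dominated_convergence[where w="\<lambda>q. (3 * norm (f q))\<^sup>2"])
    show "integrable cube_measure (\<lambda>q. (3 * norm (f q))\<^sup>2)"
      using f by (simp add: power_mult_distrib square_integrable_def)
    show "AE q in cube_measure. (\<lambda>n. (norm (s n q - f q))\<^sup>2) \<longlonglongrightarrow> 0"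
    proof (rule AE_I2)
      fix q assume "q \<in> space cube_measure"
      then have "(\<lambda>n. (norm (s n q - f q))\<^sup>2) \<longlonglongrightarrow> (norm (f q - f q))\<^sup>2"
        by (intro tendsto_intros lim)
      then show "(\<lambda>n. (norm (s n q - f q))\<^sup>2) \<longlonglongrightarrow> 0" by simp
    qed
    show "AE q in cube_measure. norm ((norm (s n q - f q))\<^sup>2) \<le> (3 * norm (f q))\<^sup>2" for n
    proof (rule AE_I2)
      fix q assume "q \<in> space cube_measure"
      then have "norm (s n q - f q) \<le> 3 * norm (f q)"
        using bound[of q n] norm_triangle_ineq4[of "s n q" "f q"] by simp
      then show "norm ((norm (s n q - f q))\<^sup>2) \<le> (3 * norm (f q))\<^sup>2"
        unfolding real_norm_def abs_power2 by (intro power_mono) auto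
    qed
  qed auto
  moreover have "(\<integral>q. (norm (s n q - f q))\<^sup>2 \<partial>cube_measure)
      = (norm (abs_cube_L2 (s n) - abs_cube_L2 f))\<^sup>2" for n
    using s f by (simp add: power2_norm_eq_inner abs_cube_L2_arith square_integrable_diff)
  ultimately have "(\<lambda>n. (norm (abs_cube_L2 (s n) - abs_cube_L2 f))\<^sup>2) \<longlonglongrightarrow> 0"
    by simp
  then have "(\<lambda>n. norm (abs_cube_L2 (s n) - abs_cube_L2 f)) \<longlonglongrightarrow> 0"
    using tendsto_real_sqrt by fastforce
  then show ?thesis
    by (simp add: tendsto_norm_zero_iff LIM_zero_iff)
qed

lemma square_integrable_indicator:
  assumes [measurable]: "A \<in> sets cube_measure"
  shows "square_integrable (\<lambda>q. indicator A q *\<^sub>R x)"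
  by (rule square_integrable_bounded[where C="norm x"]) (auto split: split_indicator)

text \<open>On a two-point set every indicator function is affine, so a cylinder indicator is a product
  of affine functions of the coordinates and expands into Walsh functions.\<close>

lemma indicator_cylinder_walsh:
  assumes "A \<in> prod_algebra {1..} (\<lambda>_. uniform_count_measure {-1, 1 :: real})"
  obtains J c where "finite J" "J \<subseteq> {1 :: nat..}"
    "\<forall>q\<in>space cube_measure. indicator A q = (\<Sum>I\<in>Pow J. c I * walsh I q)"
proof -
  obtain J E where A: "A = prod_emb {1..} (\<lambda>_. uniform_count_measure {-1, 1 :: real}) J (\<Pi>\<^sub>E j\<in>J. E j)"
    and J: "finite J" "J \<subseteq> {1..}"
    using prod_algebraE[OF assms] by metis
  \<comment> \<open>Affine interpolation at the two points: the mean of the two values and half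
    their difference.\<close>
  define a b :: "nat \<Rightarrow> real"
    where "a i = (indicator (E i) 1 + indicator (E i) (-1)) / 2"
      and "b i = (indicator (E i) 1 - indicator (E i) (-1)) / 2" for i
  have "indicator A q = (\<Sum>I\<in>Pow J. ((\<Prod>i\<in>I. b i) * (\<Prod>i\<in>J-I. a i)) * walsh I q)"
    if q: "q \<in> space cube_measure" for q
  proof -
    have "indicator A q = (\<Prod>i\<in>J. indicator (E i) (q i) :: real)"
    proof -
      have "q \<in> A \<longleftrightarrow> (\<forall>i\<in>J. q i \<in> E i)"
        using q J unfolding A space_cube_measure
        by (auto simp: prod_emb_def space_uniform_count_measure restrict_PiE_iff
            PiE_iff extensional_def)
      then show ?thesis
        using J(1) by (auto simp: indicator_def prod_zero_iff)
    qed
    also have "\<dots> = (\<Prod>i\<in>J. b i * q i + a i)"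
    proof (rule prod.cong)
      fix i assume "i \<in> J"
      then have "i \<ge> 1" using J by auto
      then show "indicator (E i) (q i) = b i * q i + a i"
        using cube_component_cases[OF q, of i] by (auto simp: a_def b_def field_simps)
    qed simp
    also have "\<dots> = (\<Sum>I\<in>Pow J. (\<Prod>i\<in>I. b i * q i) * (\<Prod>i\<in>J-I. a i))"
      by (rule prod_add) (rule J)
    also have "\<dots> = (\<Sum>I\<in>Pow J. ((\<Prod>i\<in>I. b i) * (\<Prod>i\<in>J-I. a i)) * walsh I q)"
      by (simp add: prod.distrib walsh_def mult_ac)
    finally show ?thesis .
  qed
  with J show thesis
    by (intro that[of J "\<lambda>I. (\<Prod>i\<in>I. b i) * (\<Prod>i\<in>J-I. a i)"] ballI)
qed

text \<open>Totality is phrased through functionals rather than density of a span, which is the form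
  that positivity of the variance uses. Each closure step is then linearity or continuity of
  \<open>L\<close>: from Walsh functions to cylinder indicators, by induction over disjoint unions
  and complements to all measurable indicators, then to simple functions and to L2.\<close>

lemma walsh_total:
  fixes L :: "'a::euclidean_space cube_L2 \<Rightarrow> real"
  assumes L: "bounded_linear L"
    and zero: "\<And>I x. I \<in> walsh_index \<Longrightarrow> L (abs_cube_L2 (\<lambda>q. walsh I q *\<^sub>R x)) = 0"
  shows "L = (\<lambda>_. 0)"
proof -
  interpret L: bounded_linear L by fact
  have lim0: "L (abs_cube_L2 f) = 0"
    if "\<And>n. square_integrable (s n)" "square_integrable f"
      "\<And>q. q \<in> space cube_measure \<Longrightarrow> (\<lambda>n. s n q) \<longlonglongrightarrow> f q"
      "\<And>n q. q \<in> space cube_measure \<Longrightarrow> norm (s n q) \<le> 2 * norm (f q)"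
      and "\<And>n. L (abs_cube_L2 (s n)) = 0" for f s
  proof -
    have "(\<lambda>n. L (abs_cube_L2 (s n))) \<longlonglongrightarrow> L (abs_cube_L2 f)"
      by (intro L.tendsto abs_cube_L2_tendsto that)
    then show ?thesis
      using that(5) by (simp add: LIMSEQ_const_iff)
  qed
  have L_sum: "L (abs_cube_L2 (\<lambda>q. \<Sum>i\<in>F. c i *\<^sub>R f i q)) = 0"
    if "\<And>i. i \<in> F \<Longrightarrow> square_integrable (f i)" "\<And>i. i \<in> F \<Longrightarrow> L (abs_cube_L2 (f i)) = 0"
    for F :: "'i set" and f :: "'i \<Rightarrow> (nat \<Rightarrow> real) \<Rightarrow> 'a" and c
  proof -
    have "abs_cube_L2 (\<lambda>q. \<Sum>i\<in>F. c i *\<^sub>R f i q) = (\<Sum>i\<in>F. c i *\<^sub>R abs_cube_L2 (f i))"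
      using that(1) by (subst abs_cube_L2_sum[symmetric])
        (auto intro!: square_integrable_scaleR sum.cong simp: abs_cube_L2_scaleR)
    then show ?thesis
      using that(2) by (simp add: L.sum L.scaleR)
  qed
  let ?\<Omega> = "\<Pi>\<^sub>E i\<in>{1 :: nat..}. space (uniform_count_measure {-1, 1 :: real})"
  let ?G = "prod_algebra {1 :: nat..} (\<lambda>_. uniform_count_measure {-1, 1 :: real})"
  have sets: "sets cube_measure = sigma_sets ?\<Omega> ?G" and space: "space cube_measure = ?\<Omega>"
    by (auto simp: cube_measure_def sets_PiM space_PiM)
  have ind: "L (abs_cube_L2 (\<lambda>q. indicator A q *\<^sub>R x)) = 0" if "A \<in> sets cube_measure" for A x
    using Int_stable_prod_algebra prod_algebra_sets_into_space that[unfolded sets]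
  proof (induction A rule: sigma_sets_induct_disjoint)
    case (basic A)
    from indicator_cylinder_walsh[OF this]
    obtain J c where J: "finite J" "J \<subseteq> {1 :: nat..}"
      and A: "\<forall>q\<in>space cube_measure. indicator A q = (\<Sum>I\<in>Pow J. c I * walsh I q)"
      .
    have J': "I \<in> walsh_index" if "I \<in> Pow J" for I
      using that J by (auto simp: walsh_index_def intro: finite_subset)
    have "A \<in> sets cube_measure" using basic by (auto simp: sets)
    then have "abs_cube_L2 (\<lambda>q. indicator A q *\<^sub>R x) =
        abs_cube_L2 (\<lambda>q. \<Sum>I\<in>Pow J. c I *\<^sub>R (walsh I q *\<^sub>R x))"
      using J'
      by (intro abs_cube_L2_cong square_integrable_indicator square_integrable_sum
          square_integrable_scaleR square_integrable_walsh) (auto simp: A scaleR_sum_left)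
    then show ?case
      using J' by (simp only:) (intro L_sum square_integrable_walsh zero)
  next
    case empty
    then show ?case by (simp add: abs_cube_L2_zero L.zero)
  next
    case (compl A)
    have A: "A \<in> sets cube_measure" using compl by (simp add: sets)
    \<comment> \<open>The Walsh function of the empty set is the constant 1, from which a complement
      is obtained by subtraction.\<close>
    have "{} \<in> walsh_index" by (simp add: walsh_index_def)
    note W = square_integrable_walsh[OF this, of x]
    note I = square_integrable_indicator[OF A, of x]
    have "abs_cube_L2 (\<lambda>q. indicator (space cube_measure - A) q *\<^sub>R x) =
        abs_cube_L2 (\<lambda>q. walsh {} q *\<^sub>R x - indicator A q *\<^sub>R x)"
      using A W I
      by (intro abs_cube_L2_cong square_integrable_indicator square_integrable_diff)
        (auto simp: walsh_def split: split_indicator)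
    also have "\<dots> = abs_cube_L2 (\<lambda>q. walsh {} q *\<^sub>R x) - abs_cube_L2 (\<lambda>q. indicator A q *\<^sub>R x)"
      by (rule abs_cube_L2_arith(2)[symmetric]) (rule W I)+
    finally show ?case
      using compl zero[OF \<open>{} \<in> walsh_index\<close>] unfolding space[symmetric] by (simp add: L.diff)
  next
    case (union A)
    have A: "\<And>i. A i \<in> sets cube_measure" using union by (auto simp: sets)
    show ?case
    proof (rule lim0[where s="\<lambda>n q. indicator (\<Union>i<n. A i) q *\<^sub>R x"])
      fix n
      \<comment> \<open>The factor 1 only brings the sum into the shape of
        \<open>L_sum\<close>.\<close>
      have "(\<lambda>q. indicator (\<Union>i<n. A i) q *\<^sub>R x) = (\<lambda>q. \<Sum>i<n. 1 *\<^sub>R (indicator (A i) q *\<^sub>R x))"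
      proof
        fix q
        have "indicator (\<Union>i<n. A i) q = (\<Sum>i<n. indicator (A i) q :: real)"
          using union(1) by (intro indicator_UN_disjoint) (auto intro: disjoint_family_on_mono)
        then show "indicator (\<Union>i<n. A i) q *\<^sub>R x = (\<Sum>i<n. 1 *\<^sub>R (indicator (A i) q *\<^sub>R x))"
          by (simp add: scaleR_sum_left)
      qed
      moreover have "L (abs_cube_L2 (\<lambda>q. \<Sum>i<n. 1 *\<^sub>R (indicator (A i) q *\<^sub>R x))) = 0"
        by (rule L_sum) (use A union in \<open>auto intro: square_integrable_indicator\<close>)
      ultimately show "L (abs_cube_L2 (\<lambda>q. indicator (\<Union>i<n. A i) q *\<^sub>R x)) = 0"
        by simp
    next
      fix q
      show "(\<lambda>n. indicator (\<Union>i<n. A i) q *\<^sub>R x) \<longlonglongrightarrow> indicator (\<Union>i. A i) q *\<^sub>R x"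
        by (intro tendsto_scaleR LIMSEQ_indicator_UN tendsto_const)
    qed (use A in \<open>auto intro!: square_integrable_indicator split: split_indicator\<close>)
  qed
  have "L X = 0" for X
  proof -
    obtain f where f: "square_integrable f" and X: "X = abs_cube_L2 f" by (rule cube_L2_cases)
    then have [measurable]: "f \<in> borel_measurable cube_measure"
      by (simp add: square_integrable_def)
    from borel_measurable_implies_sequence_metric[of f cube_measure 0]
    obtain s where "(\<forall>n. simple_function cube_measure (s n)) \<and>
        (\<forall>q\<in>space cube_measure. (\<lambda>n. s n q) \<longlonglongrightarrow> f q) \<and>
        (\<forall>n. \<forall>q\<in>space cube_measure. dist (s n q) 0 \<le> 2 * dist (f q) 0)"
      by auto
    then have s: "\<And>n. simple_function cube_measure (s n)"
      and lim: "\<And>q. q \<in> space cube_measure \<Longrightarrow> (\<lambda>n. s n q) \<longlonglongrightarrow> f q"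
      and bound: "\<And>n q. q \<in> space cube_measure \<Longrightarrow> norm (s n q) \<le> 2 * norm (f q)"
      by auto
    have eq: "s n q = (\<Sum>y\<in>s n ` space cube_measure.
        1 *\<^sub>R (indicator (s n -` {y} \<inter> space cube_measure) q *\<^sub>R y))"
      if "q \<in> space cube_measure" for n q
    proof -
      have "(\<Sum>y\<in>s n ` space cube_measure. 1 *\<^sub>R (indicator (s n -` {y} \<inter> space cube_measure) q *\<^sub>R y))
          = (\<Sum>y\<in>s n ` space cube_measure. if y = s n q then y else 0)"
        using that by (intro sum.cong) (auto split: split_indicator)
      also have "\<dots> = s n q"
        using that simple_functionD(1)[OF s[of n]] by (simp add: sum.delta)
      finally show ?thesis by simp
    qed
    have meas: "s n -` {y} \<inter> space cube_measure \<in> sets cube_measure" for n y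
      using s[of n] by (rule simple_functionD(2))
    have sq: "square_integrable (s n)" for n
    proof (rule square_integrable_bounded)
      show "s n \<in> borel_measurable cube_measure"
        using s[of n] by (rule borel_measurable_simple_function)
      have "finite (norm ` s n ` space cube_measure)"
        using simple_functionD(1)[OF s[of n]] by simp
      then show "norm (s n q) \<le> Max (norm ` s n ` space cube_measure)"
        if "q \<in> space cube_measure" for q
        using that by (intro Max_ge) auto
    qed
    have "L (abs_cube_L2 (s n)) = 0" for n
    proof -
      have "abs_cube_L2 (s n) = abs_cube_L2 (\<lambda>q. \<Sum>y\<in>s n ` space cube_measure.
          1 *\<^sub>R (indicator (s n -` {y} \<inter> space cube_measure) q *\<^sub>R y))"
        using eq by (intro abs_cube_L2_cong sq square_integrable_sum square_integrable_scaleR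
            square_integrable_indicator meas)
      also have "L \<dots> = 0"
        by (intro L_sum square_integrable_indicator ind meas)
      finally show ?thesis .
    qed
    then show ?thesis
      unfolding X by (intro lim0[OF sq f lim bound])
  qed
  then show ?thesis by auto
qed

section \<open>Random Walsh series\<close>

text \<open>A cofinal sequence in the net of finite index sets, which turns the unconditional limit
  into a limit along a sequence. It contains each level \<open>walsh_index_max n\<close> with
  \<open>n \<le> N\<close> as a whole, so no variance of such a level is lost in a partial
  sum.\<close>

definition walsh_cube :: "nat \<Rightarrow> nat set set" where
  "walsh_cube N = Pow {1..N}"

lemma walsh_cube_props:
  "finite (walsh_cube N)" "walsh_cube N \<subseteq> walsh_index"
  by (auto simp: walsh_cube_def walsh_index_def intro: finite_subset)

lemma filterlim_walsh_cube:
  "filterlim walsh_cube (finite_subsets_at_top walsh_index) sequentially"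
  unfolding filterlim_iff eventually_finite_subsets_at_top
proof safe
  fix P X assume X: "finite X" "X \<subseteq> walsh_index"
    and P: "\<forall>Y. finite Y \<and> X \<subseteq> Y \<and> Y \<subseteq> walsh_index \<longrightarrow> P Y"
  have "finite (\<Union>X)" using X by (auto simp: walsh_index_def)
  then obtain N where N: "\<And>I i. I \<in> X \<Longrightarrow> i \<in> I \<Longrightarrow> i \<le> N"
    unfolding finite_nat_set_iff_bounded_le by blast
  have "P (walsh_cube n)" if "n \<ge> N" for n
  proof -
    have "X \<subseteq> walsh_cube n"
      using X N that by (fastforce simp: walsh_cube_def walsh_index_def)
    then show ?thesis using P walsh_cube_props by blast
  qed
  then show "\<forall>\<^sub>F n in sequentially. P (walsh_cube n)"
    by (auto simp: eventually_sequentially)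
qed

lemma walsh_index_max_subset_cube:
  assumes "n \<le> N"
  shows "walsh_index_max n \<subseteq> walsh_cube N"
proof
  fix I assume I: "I \<in> walsh_index_max n"
  have "i \<in> {1..N}" if "i \<in> I" for i
    using I that Max_ge[of I i] assms by (auto simp: walsh_index_max_def walsh_index_def)
  then show "I \<in> walsh_cube N" by (auto simp: walsh_cube_def)
qed

lemma finite_walsh_index_max: "finite (walsh_index_max n)"
  using walsh_index_max_subset_cube[of n n] walsh_cube_props(1) finite_subset by blast

lemma walsh_flip_last:
  assumes I: "I \<in> walsh_index_max n" and eq: "\<And>i. i \<in> {1..<n} \<Longrightarrow> q' i = q i" and n: "q' n = - q n"
  shows "walsh I q' = - walsh I q"
proof -
  have fin: "finite I" and nI: "n \<in> I" and sub: "I - {n} \<subseteq> {1..<n}"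
    using I Max_in[of I] by (auto simp: walsh_index_max_def walsh_index_def le_neq_implies_less)
  have "walsh I q' = q' n * (\<Prod>i\<in>I-{n}. q' i)"
    unfolding walsh_def by (rule prod.remove[OF fin nI])
  also have "(\<Prod>i\<in>I-{n}. q' i) = (\<Prod>i\<in>I-{n}. q i)"
    using sub eq by (intro prod.cong) auto
  also have "q' n * \<dots> = - (q n * (\<Prod>i\<in>I-{n}. q i))" by (simp add: n)
  also have "\<dots> = - walsh I q"
    unfolding walsh_def by (subst prod.remove[OF fin nI]) simp
  finally show ?thesis .
qed

text \<open>With the first point fixed, the sign pattern prescribes \<open>n\<close> coordinates of
  the second. The pattern that is 1 except for -1 at \<open>n\<close> describes a first difference
  at \<open>n\<close>; the constant pattern describes agreement up to \<open>n\<close>.\<close>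

lemma emeasure_cube_pair_cylinder:
  fixes n :: nat and \<epsilon> :: "nat \<Rightarrow> real"
  assumes \<epsilon>: "\<And>i. \<epsilon> i = -1 \<or> \<epsilon> i = 1"
  defines "D \<equiv> {z \<in> space (cube_measure \<Otimes>\<^sub>M cube_measure). \<forall>i\<in>{1..n}. snd z i = \<epsilon> i * fst z i}"
  shows "D \<in> sets (cube_measure \<Otimes>\<^sub>M cube_measure)"
    "emeasure (cube_measure \<Otimes>\<^sub>M cube_measure) D = ennreal ((1 / 2) ^ n)"
proof -
  have [measurable]: "(\<lambda>z. fst z i) \<in> borel_measurable (cube_measure \<Otimes>\<^sub>M cube_measure)"
    "(\<lambda>z. snd z i) \<in> borel_measurable (cube_measure \<Otimes>\<^sub>M cube_measure)" if "i \<in> {1..n}" for i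
    using that
    by (auto intro: measurable_compose[OF measurable_fst borel_measurable_cube_component]
        measurable_compose[OF measurable_snd borel_measurable_cube_component])
  show D: "D \<in> sets (cube_measure \<Otimes>\<^sub>M cube_measure)"
    unfolding D_def by measurable
  have "emeasure (cube_measure \<Otimes>\<^sub>M cube_measure) D =
      (\<integral>\<^sup>+q. emeasure cube_measure (Pair q -` D) \<partial>cube_measure)"
    by (rule cube.emeasure_pair_measure_alt[OF D])
  also have "\<dots> = (\<integral>\<^sup>+q. ennreal ((1 / 2) ^ n) \<partial>cube_measure)"
  proof (rule nn_integral_cong)
    fix q assume q: "q \<in> space cube_measure"
    have "Pair q -` D = {q' \<in> space cube_measure. \<forall>i\<in>{1..n}. q' i = \<epsilon> i * q i}"
      using q by (auto simp: D_def space_pair_measure)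
    also have "emeasure cube_measure \<dots> = ennreal ((1 / 2) ^ n)"
    proof (rule emeasure_cube_cylinder)
      fix i assume "i \<in> {1..n}"
      then show "\<epsilon> i * q i = -1 \<or> \<epsilon> i * q i = 1"
        using \<epsilon>[of i] cube_component_cases[OF q, of i] by auto
    qed
    finally show "emeasure cube_measure (Pair q -` D) = ennreal ((1 / 2) ^ n)" .
  qed
  finally show "emeasure (cube_measure \<Otimes>\<^sub>M cube_measure) D = ennreal ((1 / 2) ^ n)"
    by (simp add: cube.emeasure_space_1)
qed

text \<open>Since \<open>iexp\<close> is 1-Lipschitz, L1 convergence of random variables gives
  convergence of characteristic functions with an explicit rate.\<close>

lemma (in prob_space) norm_char_diff_le:
  assumes [measurable]: "X \<in> borel_measurable M" "Y \<in> borel_measurable M"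
    and "(\<integral>\<^sup>+\<omega>. ennreal \<bar>X \<omega> - Y \<omega>\<bar> \<partial>M) \<le> ennreal e" "e \<ge> 0"
  shows "norm (char (distr M borel X) t - char (distr M borel Y) t) \<le> \<bar>t\<bar> * e"
proof -
  have lip: "norm (iexp x - iexp y) \<le> \<bar>x - y\<bar>" for x y
  proof -
    have "iexp x - iexp y = iexp y * (iexp (x - y) - 1)"
      by (simp add: algebra_simps flip: exp_add)
    then have "norm (iexp x - iexp y) = norm (iexp (x - y) - 1)"
      by (simp add: norm_mult)
    also have "\<dots> \<le> \<bar>x - y\<bar>"
      using iexp_approx1[of "x - y" 0] by simp
    finally show ?thesis .
  qed
  have "char (distr M borel X) t - char (distr M borel Y) t =
      (CLINT \<omega>|M. iexp (t * X \<omega>) - iexp (t * Y \<omega>))"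
    unfolding char_def
    by (subst Bochner_Integration.integral_diff)
      (auto simp: integral_distr intro!: integrable_const_bound[where B=1])
  then have "ennreal (norm (char (distr M borel X) t - char (distr M borel Y) t)) \<le>
      (\<integral>\<^sup>+\<omega>. ennreal (norm (iexp (t * X \<omega>) - iexp (t * Y \<omega>))) \<partial>M)"
    by (simp only:) (intro integral_norm_bound_ennreal Bochner_Integration.integrable_diff
      integrable_const_bound[where B=1], auto)
  also have "\<dots> \<le> (\<integral>\<^sup>+\<omega>. ennreal \<bar>t\<bar> * ennreal \<bar>X \<omega> - Y \<omega>\<bar> \<partial>M)"
  proof (intro nn_integral_mono)
    fix \<omega>
    have "norm (iexp (t * X \<omega>) - iexp (t * Y \<omega>)) \<le> \<bar>t\<bar> * \<bar>X \<omega> - Y \<omega>\<bar>"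
      using lip[of "t * X \<omega>" "t * Y \<omega>"] by (simp add: abs_mult flip: right_diff_distrib)
    then show "ennreal (norm (iexp (t * X \<omega>) - iexp (t * Y \<omega>))) \<le> ennreal \<bar>t\<bar> * ennreal \<bar>X \<omega> - Y \<omega>\<bar>"
      by (simp add: ennreal_leI flip: ennreal_mult)
  qed
  also have "\<dots> = ennreal \<bar>t\<bar> * (\<integral>\<^sup>+\<omega>. ennreal \<bar>X \<omega> - Y \<omega>\<bar> \<partial>M)"
    by (rule nn_integral_cmult) measurable
  also have "\<dots> \<le> ennreal \<bar>t\<bar> * ennreal e"
    by (intro mult_left_mono assms) simp
  also have "\<dots> = ennreal (\<bar>t\<bar> * e)"
    using \<open>e \<ge> 0\<close> by (simp add: ennreal_mult)
  finally show ?thesis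
    using \<open>e \<ge> 0\<close> by (subst (asm) ennreal_le_iff) auto
qed

text \<open>Applied to the squared distance from a base point, whose measurability would require the
  triangle inequality for \<open>W2\<close>.\<close>

lemma nn_integral_distr_le:
  assumes T: "T \<in> measurable M N"
  shows "(\<integral>\<^sup>+y. f y \<partial>distr M N T) \<le> (\<integral>\<^sup>+x. f (T x) \<partial>M)"
  unfolding nn_integral_def[of "distr M N T"]
proof (rule SUP_least)
  \<comment> \<open>The integral of an arbitrary function is the supremum over simple functions
    below it. Change of variables holds for each of these, and the inequality survives in the
    supremum.\<close>
  fix g assume g: "g \<in> {g. simple_function (distr M N T) g \<and> g \<le> f}"
  then have g': "simple_function (distr M N T) g" and le: "\<And>y. g y \<le> f y"
    by (auto simp: le_fun_def)
  have [measurable]: "g \<in> borel_measurable N"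
    using borel_measurable_simple_function[OF g'] by simp
  have "integral\<^sup>S (distr M N T) g = (\<integral>\<^sup>+y. g y \<partial>distr M N T)"
    using g' by (rule nn_integral_eq_simple_integral[symmetric])
  also have "\<dots> = (\<integral>\<^sup>+x. g (T x) \<partial>M)"
    using T by (rule nn_integral_distr) simp
  also have "\<dots> \<le> (\<integral>\<^sup>+x. f (T x) \<partial>M)"
    by (intro nn_integral_mono le)
  finally show "integral\<^sup>S (distr M N T) g \<le> (\<integral>\<^sup>+x. f (T x) \<partial>M)" .
qed

section \<open>The Gaussian series and its partial sums\<close>

locale gaussian_walsh_series = prob_space P
  for P :: "'w measure" +
  fixes \<Sigma> :: "nat set \<Rightarrow> real^'d^'d"
    and \<alpha> \<beta> :: "nat set \<Rightarrow> real"
    and \<xi> :: "nat set \<Rightarrow> 'w \<Rightarrow> real^'d"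
    and \<Xi> :: "'w \<Rightarrow> (real^'d) cube_L2"
    and A :: "nat \<Rightarrow> real"
  assumes \<alpha>_pos: "\<And>I. I \<in> walsh_index \<Longrightarrow> 0 < (\<alpha> I)\<^sup>2"
    and \<Sigma>_bounds: "\<And>I v. I \<in> walsh_index \<Longrightarrow> norm v = 1 \<Longrightarrow>
           (\<alpha> I)\<^sup>2 \<le> (\<Sigma> I *v v) \<bullet> v \<and> (\<Sigma> I *v v) \<bullet> v \<le> (\<beta> I)\<^sup>2"
    and \<beta>_summable: "(\<lambda>I. (\<beta> I)\<^sup>2) summable_on walsh_index"
    and indep: "indep_vars (\<lambda>_. borel) \<xi> walsh_index"
    and law: "\<And>I. I \<in> walsh_index \<Longrightarrow> centered_gaussian (\<Sigma> I) (distr P borel (\<xi> I))"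
    and series: "is_walsh_series P \<xi> \<Xi>"
    and A_eq: "\<And>n. n \<ge> 1 \<Longrightarrow> A n = sqrt (\<Sum>I\<in>walsh_index_max n. (\<alpha> I)\<^sup>2)"
    and A_summable: "(\<lambda>n. 1 / (2 ^ n * A n ^ CARD('d))) summable_on {1..}"
begin

lemma measurable_\<xi> [measurable]: "I \<in> walsh_index \<Longrightarrow> \<xi> I \<in> borel_measurable P"
  using indep by (auto simp: indep_vars_def)

lemma measurable_\<Xi> [measurable]: "\<Xi> \<in> borel_measurable P"
  using series by (simp add: is_walsh_series_def)

lemma quadratic_form_bounds:
  assumes "I \<in> walsh_index"
  shows "(\<alpha> I)\<^sup>2 * (norm v)\<^sup>2 \<le> (\<Sigma> I *v v) \<bullet> v" "(\<Sigma> I *v v) \<bullet> v \<le> (\<beta> I)\<^sup>2 * (norm v)\<^sup>2"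
proof -
  have "(\<alpha> I)\<^sup>2 * (norm v)\<^sup>2 \<le> (\<Sigma> I *v v) \<bullet> v \<and> (\<Sigma> I *v v) \<bullet> v \<le> (\<beta> I)\<^sup>2 * (norm v)\<^sup>2"
  proof (cases "v = 0")
    case False
    define u where "u = v /\<^sub>R norm v"
    have u: "norm u = 1" "v = norm v *\<^sub>R u" using False by (auto simp: u_def)
    have "(\<Sigma> I *v v) \<bullet> v = (norm v)\<^sup>2 * ((\<Sigma> I *v u) \<bullet> u)"
      by (subst (1 2) u(2)) (simp add: matrix_vector_mult_scaleR power2_eq_square)
    then show ?thesis
      using \<Sigma>_bounds[OF assms u(1)]
      by (simp add: mult.commute[of _ "(norm v)\<^sup>2"] mult_left_mono)
  qed simp
  then show "(\<alpha> I)\<^sup>2 * (norm v)\<^sup>2 \<le> (\<Sigma> I *v v) \<bullet> v" "(\<Sigma> I *v v) \<bullet> v \<le> (\<beta> I)\<^sup>2 * (norm v)\<^sup>2"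
    by auto
qed

lemma quadratic_form_nonneg: "I \<in> walsh_index \<Longrightarrow> 0 \<le> (\<Sigma> I *v v) \<bullet> v"
  using quadratic_form_bounds(1)[of I v] by (meson mult_nonneg_nonneg order_trans zero_le_power2)

lemma distr_inner_\<xi>:
  assumes "I \<in> walsh_index"
  shows "distr P borel (\<lambda>\<omega>. v \<bullet> \<xi> I \<omega>) = normal_law 0 ((\<Sigma> I *v v) \<bullet> v)"
proof -
  have "distr (distr P borel (\<xi> I)) borel (\<lambda>x. v \<bullet> x) = normal_law 0 ((\<Sigma> I *v v) \<bullet> v)"
    using law[OF assms] by (simp add: centered_gaussian_def)
  then show ?thesis
    using assms by (simp add: distr_distr comp_def)
qed

text \<open>The vector may depend on the index because two applications share the formula:
  coefficients of a functional, and a fixed direction times the difference of a Walsh function at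
  two points.\<close>

lemma char_sum_inner_\<xi>:
  assumes "F \<subseteq> walsh_index"
  shows "char (distr P borel (\<lambda>\<omega>. \<Sum>I\<in>F. v I \<bullet> \<xi> I \<omega>)) t =
    complex_of_real (exp (- ((\<Sum>I\<in>F. (\<Sigma> I *v v I) \<bullet> v I) * t\<^sup>2) / 2))"
proof -
  have "indep_vars (\<lambda>_. borel) (\<lambda>I \<omega>. v I \<bullet> \<xi> I \<omega>) F"
    by (rule indep_vars_compose2[OF indep_vars_subset[OF indep assms]]) simp
  then have "char (distr P borel (\<lambda>\<omega>. \<Sum>I\<in>F. v I \<bullet> \<xi> I \<omega>)) t =
      (\<Prod>I\<in>F. char (distr P borel (\<lambda>\<omega>. v I \<bullet> \<xi> I \<omega>)) t)"
    by (rule char_distr_sum)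
  also have "\<dots> = (\<Prod>I\<in>F. complex_of_real (exp (- (((\<Sigma> I *v v I) \<bullet> v I) * t\<^sup>2) / 2)))"
    using assms
    by (intro prod.cong) (auto simp: distr_inner_\<xi> char_normal_law quadratic_form_nonneg subset_iff)
  \<comment> \<open>For infinite \<open>F\<close> both sides are 1, by the conventions for sums and
    products over infinite sets.\<close>
  also have "\<dots> = complex_of_real (exp (- ((\<Sum>I\<in>F. (\<Sigma> I *v v I) \<bullet> v I) * t\<^sup>2) / 2))"
    by (cases "finite F")
      (simp_all add: exp_sum sum_distrib_right sum_divide_distrib flip: sum_negf)
  finally show ?thesis .
qed

text \<open>A pointwise representative, not a class: the kernel compares values at two given points
  of the cube.\<close>

definition partial :: "nat \<Rightarrow> 'w \<Rightarrow> (nat \<Rightarrow> real) \<Rightarrow> real^'d" where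
  "partial N \<omega> q = (\<Sum>I\<in>walsh_cube N. walsh I q *\<^sub>R \<xi> I \<omega>)"

lemma square_integrable_partial: "square_integrable (partial N \<omega>)"
  unfolding partial_def using walsh_cube_props(2)
  by (intro square_integrable_sum square_integrable_walsh) auto

lemma abs_partial:
  "abs_cube_L2 (partial N \<omega>) = (\<Sum>I\<in>walsh_cube N. abs_cube_L2 (\<lambda>q. walsh I q *\<^sub>R \<xi> I \<omega>))"
  unfolding partial_def using walsh_cube_props(2)
  by (intro abs_cube_L2_sum[symmetric] square_integrable_walsh) auto

lemma measurable_partial [measurable]:
  "(\<lambda>z. partial N (fst z) (snd z)) \<in> borel_measurable (P \<Otimes>\<^sub>M cube_measure)"
  unfolding partial_def
proof (rule borel_measurable_sum)
  fix I assume "I \<in> walsh_cube N"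
  then have [measurable]: "I \<in> walsh_index" using walsh_cube_props(2) by auto
  show "(\<lambda>z. walsh I (snd z) *\<^sub>R \<xi> I (fst z)) \<in> borel_measurable (P \<Otimes>\<^sub>M cube_measure)"
    by measurable
qed

lemma partial_tendsto:
  "(\<lambda>N. \<integral>\<^sup>+\<omega>. ennreal ((norm (\<Xi> \<omega> - abs_cube_L2 (partial N \<omega>)))\<^sup>2) \<partial>P) \<longlonglongrightarrow> 0"
  unfolding abs_partial
  using filterlim_compose[OF _ filterlim_walsh_cube] series
  unfolding is_walsh_series_def by blast

text \<open>Applied to two Lipschitz observables of the series, a functional and the energy.
  Measurability is demanded of these real quantities; the Hilbert space remainder enters only
  through monotonicity of the integral, and Cauchy-Schwarz passes from L2 to L1.\<close>

lemma eventually_nn_integral_partial_le: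
  assumes [measurable]: "X \<in> borel_measurable P" "\<And>N. Y N \<in> borel_measurable P"
    and le: "\<And>N \<omega>. \<bar>X \<omega> - Y N \<omega>\<bar> \<le> K * norm (\<Xi> \<omega> - abs_cube_L2 (partial N \<omega>))"
    and "K > 0" "e > 0"
  shows "\<forall>\<^sub>F N in sequentially. (\<integral>\<^sup>+\<omega>. ennreal \<bar>X \<omega> - Y N \<omega>\<bar> \<partial>P) \<le> ennreal e"
proof -
  have "ennreal ((e / K)\<^sup>2) > 0" using \<open>K > 0\<close> \<open>e > 0\<close> by simp
  from order_tendstoD(2)[OF partial_tendsto this]
  show ?thesis
  proof eventually_elim
    case (elim N)
    have "(\<integral>\<^sup>+\<omega>. ennreal (((X \<omega> - Y N \<omega>) / K)\<^sup>2) \<partial>P)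
        \<le> (\<integral>\<^sup>+\<omega>. ennreal ((norm (\<Xi> \<omega> - abs_cube_L2 (partial N \<omega>)))\<^sup>2) \<partial>P)"
    proof (intro nn_integral_mono ennreal_leI)
      fix \<omega>
      have "\<bar>(X \<omega> - Y N \<omega>) / K\<bar> \<le> norm (\<Xi> \<omega> - abs_cube_L2 (partial N \<omega>))"
        using le[of \<omega> N] \<open>K > 0\<close> by (simp add: field_simps)
      then show "((X \<omega> - Y N \<omega>) / K)\<^sup>2 \<le> (norm (\<Xi> \<omega> - abs_cube_L2 (partial N \<omega>)))\<^sup>2"
        by (rule power2_le_iff_abs_le[THEN iffD2, rotated]) simp
    qed
    then have "(\<integral>\<^sup>+\<omega>. ennreal \<bar>(X \<omega> - Y N \<omega>) / K\<bar> \<partial>P) \<le> ennreal (e / K)"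
      using elim \<open>K > 0\<close> \<open>e > 0\<close> by (intro nn_integral_abs_le_of_square) auto
    then have "ennreal K * (\<integral>\<^sup>+\<omega>. ennreal \<bar>(X \<omega> - Y N \<omega>) / K\<bar> \<partial>P) \<le> ennreal K * ennreal (e / K)"
      by (rule mult_left_mono) simp
    also have "ennreal K * ennreal (e / K) = ennreal e"
      using \<open>K > 0\<close> \<open>e > 0\<close> by (simp flip: ennreal_mult)
    also have "ennreal K * (\<integral>\<^sup>+\<omega>. ennreal \<bar>(X \<omega> - Y N \<omega>) / K\<bar> \<partial>P) =
        (\<integral>\<^sup>+\<omega>. ennreal K * ennreal \<bar>(X \<omega> - Y N \<omega>) / K\<bar> \<partial>P)"
      by (rule nn_integral_cmult[symmetric]) measurable
    also have "\<dots> = (\<integral>\<^sup>+\<omega>. ennreal \<bar>X \<omega> - Y N \<omega>\<bar> \<partial>P)"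
      using \<open>K > 0\<close> by (intro nn_integral_cong) (simp flip: ennreal_mult)
    finally show ?case .
  qed
qed

section \<open>Second moments\<close>

lemma nn_integral_norm_\<xi>_finite:
  assumes "I \<in> walsh_index"
  shows "(\<integral>\<^sup>+\<omega>. ennreal ((norm (\<xi> I \<omega>))\<^sup>2) \<partial>P) < \<infinity>"
proof -
  note [measurable] = measurable_\<xi>[OF assms]
  have "(\<integral>\<^sup>+\<omega>. ennreal ((norm (\<xi> I \<omega>))\<^sup>2) \<partial>P) =
      (\<integral>\<^sup>+\<omega>. (\<Sum>b\<in>Basis. ennreal ((b \<bullet> \<xi> I \<omega>)\<^sup>2)) \<partial>P)"
  proof (rule nn_integral_cong)
    fix \<omega>
    have "(norm (\<xi> I \<omega>))\<^sup>2 = (\<Sum>b\<in>Basis. (b \<bullet> \<xi> I \<omega>)\<^sup>2)"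
      by (simp add: power2_norm_eq_inner euclidean_inner[of "\<xi> I \<omega>" "\<xi> I \<omega>"] inner_commute
          flip: power2_eq_square)
    then show "ennreal ((norm (\<xi> I \<omega>))\<^sup>2) = (\<Sum>b\<in>Basis. ennreal ((b \<bullet> \<xi> I \<omega>)\<^sup>2))"
      by simp
  qed
  also have "\<dots> = (\<Sum>b\<in>Basis. (\<integral>\<^sup>+\<omega>. ennreal ((b \<bullet> \<xi> I \<omega>)\<^sup>2) \<partial>P))"
    by (rule nn_integral_sum) measurable
  also have "\<dots> = (\<Sum>b\<in>Basis. (\<integral>\<^sup>+x. ennreal (x\<^sup>2) \<partial>normal_law 0 ((\<Sigma> I *v b) \<bullet> b)))"
    by (intro sum.cong) (auto simp: nn_integral_distr simp flip: distr_inner_\<xi>[OF assms])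
  also have "\<dots> < \<infinity>"
    using nn_integral_normal_law_square_finite quadratic_form_nonneg[OF assms]
    by (simp add: less_top)
  finally show ?thesis .
qed

text \<open>One partial sum at squared L2 distance below 1 is enough, since a finite sum of Gaussian
  vectors has a second moment.\<close>

lemma nn_integral_norm_\<Xi>_finite: "(\<integral>\<^sup>+\<omega>. ennreal ((norm (\<Xi> \<omega>))\<^sup>2) \<partial>P) < \<infinity>"
proof -
  obtain N where N: "(\<integral>\<^sup>+\<omega>. ennreal ((norm (\<Xi> \<omega> - abs_cube_L2 (partial N \<omega>)))\<^sup>2) \<partial>P) < 1"
    using eventually_happens[OF order_tendstoD(2)[OF partial_tendsto zero_less_one]] by auto
  define F where "F = walsh_cube N"
  have F: "finite F" "F \<subseteq> walsh_index" using walsh_cube_props by (auto simp: F_def)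
  have [measurable]: "I \<in> F \<Longrightarrow> \<xi> I \<in> borel_measurable P" for I using F by auto
  have norm_le: "(norm (abs_cube_L2 (partial N \<omega>)))\<^sup>2 \<le> card F * (\<Sum>I\<in>F. (norm (\<xi> I \<omega>))\<^sup>2)" for \<omega>
  proof -
    have "norm (abs_cube_L2 (partial N \<omega>)) \<le> (\<Sum>I\<in>F. norm (\<xi> I \<omega>))"
      unfolding abs_partial F_def[symmetric] using F(2)
      by (intro order_trans[OF norm_sum] sum_mono) (auto simp: norm_walsh subset_iff)
    then have "(norm (abs_cube_L2 (partial N \<omega>)))\<^sup>2 \<le> (\<Sum>I\<in>F. norm (\<xi> I \<omega>))\<^sup>2"
      by (intro power_mono) auto
    also have "\<dots> \<le> (\<Sum>I\<in>F. (norm (\<xi> I \<omega>))\<^sup>2) * card F"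
      by (rule sum_squared_le_sum_of_squares)
    finally show ?thesis by (simp add: mult.commute)
  qed
  \<comment> \<open>The 2 is that of \<open>norm_add_power2_le\<close>, the cardinality comes from
    Cauchy-Schwarz for the sum of norms.\<close>
  define B where "B \<omega> = 2 * real (card F) * (\<Sum>I\<in>F. (norm (\<xi> I \<omega>))\<^sup>2)" for \<omega>
  have B0: "B \<omega> \<ge> 0" for \<omega> by (simp add: B_def sum_nonneg)
  have [measurable]: "B \<in> borel_measurable P" unfolding B_def by measurable
  have B: "(\<integral>\<^sup>+\<omega>. ennreal (B \<omega>) \<partial>P) < \<infinity>"
  proof -
    have "(\<integral>\<^sup>+\<omega>. ennreal (B \<omega>) \<partial>P) =
        (\<integral>\<^sup>+\<omega>. ennreal (2 * real (card F)) * (\<Sum>I\<in>F. ennreal ((norm (\<xi> I \<omega>))\<^sup>2)) \<partial>P)"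
      unfolding B_def by (intro nn_integral_cong) (simp add: ennreal_mult sum_nonneg)
    also have "\<dots> = ennreal (2 * real (card F)) * (\<Sum>I\<in>F. (\<integral>\<^sup>+\<omega>. ennreal ((norm (\<xi> I \<omega>))\<^sup>2) \<partial>P))"
      by (subst nn_integral_cmult) (measurable, simp add: nn_integral_sum del: sum_ennreal)
    also have "\<dots> < \<infinity>"
      using nn_integral_norm_\<xi>_finite F by (auto intro!: ennreal_mult_less_top[THEN iffD2] simp: less_top subset_iff)
    finally show ?thesis .
  qed
  have le: "(norm (\<Xi> \<omega>))\<^sup>2 \<le> 2 * (norm (\<Xi> \<omega> - abs_cube_L2 (partial N \<omega>)))\<^sup>2 + B \<omega>" for \<omega>
    using norm_add_power2_le[of "\<Xi> \<omega> - abs_cube_L2 (partial N \<omega>)" "abs_cube_L2 (partial N \<omega>)"]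
      norm_le[of \<omega>] by (simp add: B_def)
  text \<open>The integrand \<open>\<Xi> - partial N\<close> need not be measurable, so it is only used as an upper
    bound.\<close>
  have "(\<integral>\<^sup>+\<omega>. ennreal (((norm (\<Xi> \<omega>))\<^sup>2 - B \<omega>) / 2) \<partial>P) \<le>
      (\<integral>\<^sup>+\<omega>. ennreal ((norm (\<Xi> \<omega> - abs_cube_L2 (partial N \<omega>)))\<^sup>2) \<partial>P)"
    using le by (intro nn_integral_mono ennreal_leI) (simp add: field_simps)
  then have fin: "(\<integral>\<^sup>+\<omega>. ennreal (((norm (\<Xi> \<omega>))\<^sup>2 - B \<omega>) / 2) \<partial>P) < \<infinity>"
    using less_trans[OF le_less_trans[OF _ N] ennreal_one_less_top] by simp
  \<comment> \<open>On the measurable side \<open>B\<close> is added back. \<open>ennreal\<close>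
    cuts negative numbers off at 0, hence the case split.\<close>
  have "(\<integral>\<^sup>+\<omega>. ennreal ((norm (\<Xi> \<omega>))\<^sup>2) \<partial>P) \<le>
      (\<integral>\<^sup>+\<omega>. 2 * ennreal (((norm (\<Xi> \<omega>))\<^sup>2 - B \<omega>) / 2) + ennreal (B \<omega>) \<partial>P)"
  proof (rule nn_integral_mono)
    fix \<omega>
    show "ennreal ((norm (\<Xi> \<omega>))\<^sup>2) \<le> 2 * ennreal (((norm (\<Xi> \<omega>))\<^sup>2 - B \<omega>) / 2) + ennreal (B \<omega>)"
    proof (cases "(norm (\<Xi> \<omega>))\<^sup>2 \<le> B \<omega>")
      case True
      then show ?thesis by (simp add: ennreal_leI add_increasing)
    next
      case False
      then have "2 * ennreal (((norm (\<Xi> \<omega>))\<^sup>2 - B \<omega>) / 2) = ennreal ((norm (\<Xi> \<omega>))\<^sup>2 - B \<omega>)"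
        by (subst ennreal_numeral[symmetric], subst ennreal_mult[symmetric]) auto
      then show ?thesis
        using False B0[of \<omega>] by (simp flip: ennreal_plus)
    qed
  qed
  also have "\<dots> = 2 * (\<integral>\<^sup>+\<omega>. ennreal (((norm (\<Xi> \<omega>))\<^sup>2 - B \<omega>) / 2) \<partial>P) + (\<integral>\<^sup>+\<omega>. ennreal (B \<omega>) \<partial>P)"
    by (simp add: nn_integral_add nn_integral_cmult)
  also have "\<dots> < \<infinity>"
    using fin B by (auto intro!: ennreal_mult_less_top[THEN iffD2])
  finally show ?thesis .
qed

text \<open>The limit law need not be constructed, because L(\<Xi>) is already given: L1 convergence
  of the finite sums identifies its characteristic function, and uniqueness does the rest. The total
  variance dominates the contribution of any single index, so one nonzero coefficient makes it
  positive.\<close>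

lemma distr_functional_\<Xi>:
  assumes "bounded_linear L"
  shows "\<exists>s\<ge>0. distr P borel (\<lambda>\<omega>. L (\<Xi> \<omega>)) = normal_law 0 s \<and> (L \<noteq> (\<lambda>_. 0) \<longrightarrow> s > 0)"
proof -
  interpret L: bounded_linear L by fact
  obtain K where K: "K > 0" "\<And>X. \<bar>L X\<bar> \<le> norm X * K"
    using L.pos_bounded by auto
  have [measurable]: "L \<in> borel_measurable borel"
    by (intro borel_measurable_continuous_onI L.continuous_on continuous_on_id)
  \<comment> \<open>The vector representing \<open>L\<close> on the copy of the Euclidean space
    carried by the Walsh function of \<open>I\<close>; only finite-dimensional duality is
    involved.\<close>
  define v where "v I = (\<Sum>b\<in>Basis. L (abs_cube_L2 (\<lambda>q. walsh I q *\<^sub>R b)) *\<^sub>R b)" for I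
  have v: "L (abs_cube_L2 (\<lambda>q. walsh I q *\<^sub>R x)) = v I \<bullet> x" if "I \<in> walsh_index" for I x
  proof -
    note W = square_integrable_walsh[OF that]
    have "abs_cube_L2 (\<lambda>q. walsh I q *\<^sub>R x) =
        abs_cube_L2 (\<lambda>q. \<Sum>b\<in>Basis. (x \<bullet> b) *\<^sub>R (walsh I q *\<^sub>R b))"
    proof (rule arg_cong[where f=abs_cube_L2], rule ext)
      fix q
      have "walsh I q *\<^sub>R x = walsh I q *\<^sub>R (\<Sum>b\<in>Basis. (x \<bullet> b) *\<^sub>R b)"
        by (simp only: euclidean_representation)
      then show "walsh I q *\<^sub>R x = (\<Sum>b\<in>Basis. (x \<bullet> b) *\<^sub>R (walsh I q *\<^sub>R b))"
        by (simp only: scaleR_sum_right scaleR_left_commute)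
    qed
    also have "\<dots> = (\<Sum>b\<in>Basis. (x \<bullet> b) *\<^sub>R abs_cube_L2 (\<lambda>q. walsh I q *\<^sub>R b))"
      by (subst abs_cube_L2_sum[symmetric]) (auto intro: square_integrable_scaleR W
          simp only: abs_cube_L2_scaleR[OF W])
    also have "L \<dots> = (\<Sum>b\<in>Basis. (x \<bullet> b) * L (abs_cube_L2 (\<lambda>q. walsh I q *\<^sub>R b)))"
      by (simp only: L.sum L.scaleR real_scaleR_def)
    also have "\<dots> = v I \<bullet> x"
      unfolding v_def inner_sum_left
      by (intro sum.cong) (simp_all add: inner_commute mult.commute)
    finally show ?thesis .
  qed
  have norm_v: "norm (v I) \<le> K" if "I \<in> walsh_index" for I
  proof -
    \<comment> \<open>\<open>L\<close> is tested on the Walsh function times \<open>v I\<close>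
      itself, an element of norm \<open>norm (v I)\<close>.\<close>
    have "norm (v I) * norm (v I) \<le> norm (v I) * K"
      using K(2)[of "abs_cube_L2 (\<lambda>q. walsh I q *\<^sub>R v I)"] that
      by (simp add: v norm_walsh flip: power2_eq_square power2_norm_eq_inner)
    then show ?thesis using K(1) by (cases "v I = 0") auto
  qed
  define \<sigma> where "\<sigma> I = (\<Sigma> I *v v I) \<bullet> v I" for I
  have \<sigma>_nonneg: "\<sigma> I \<ge> 0" if "I \<in> walsh_index" for I
    unfolding \<sigma>_def by (rule quadratic_form_nonneg) fact
  have \<sigma>_summable: "\<sigma> summable_on walsh_index"
  proof (rule summable_on_comparison_test)
    show "(\<lambda>I. (\<beta> I)\<^sup>2 * K\<^sup>2) summable_on walsh_index"
      by (intro summable_on_cmult_left \<beta>_summable)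
    fix I assume I: "I \<in> walsh_index"
    have "\<sigma> I \<le> (\<beta> I)\<^sup>2 * (norm (v I))\<^sup>2"
      unfolding \<sigma>_def by (rule quadratic_form_bounds(2)[OF I])
    also have "\<dots> \<le> (\<beta> I)\<^sup>2 * K\<^sup>2"
      by (intro mult_left_mono power_mono norm_v I) auto
    finally show "\<sigma> I \<le> (\<beta> I)\<^sup>2 * K\<^sup>2" .
  qed (use \<sigma>_nonneg in auto)
  define s where "s = infsum \<sigma> walsh_index"
  have "(\<sigma> has_sum s) walsh_index"
    using \<sigma>_summable by (simp add: s_def has_sum_infsum)
  then have s_lim: "(\<lambda>N. sum \<sigma> (walsh_cube N)) \<longlonglongrightarrow> s"
    unfolding has_sum_def by (rule filterlim_compose[OF _ filterlim_walsh_cube])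
  have "s \<ge> 0" unfolding s_def by (intro infsum_nonneg \<sigma>_nonneg)
  define Y where "Y N \<omega> = (\<Sum>I\<in>walsh_cube N. v I \<bullet> \<xi> I \<omega>)" for N \<omega>
  have Y_meas [measurable]: "Y N \<in> borel_measurable P" for N
    unfolding Y_def using walsh_cube_props(2)[of N]
    by (intro borel_measurable_sum borel_measurable_inner) auto
  have L_partial: "L (abs_cube_L2 (partial N \<omega>)) = Y N \<omega>" for N \<omega>
    unfolding abs_partial L.sum Y_def using walsh_cube_props(2)[of N]
    by (intro sum.cong) (auto simp: v)
  have le: "\<bar>L (\<Xi> \<omega>) - Y N \<omega>\<bar> \<le> K * norm (\<Xi> \<omega> - abs_cube_L2 (partial N \<omega>))" for N \<omega>
    using K(2)[of "\<Xi> \<omega> - abs_cube_L2 (partial N \<omega>)"] by (simp add: L.diff L_partial mult.commute)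
  have LX_meas [measurable]: "(\<lambda>\<omega>. L (\<Xi> \<omega>)) \<in> borel_measurable P" by measurable
  have "char (distr P borel (\<lambda>\<omega>. L (\<Xi> \<omega>))) t = char (normal_law 0 s) t" for t
  proof (rule LIMSEQ_unique)
    show "(\<lambda>N. char (distr P borel (Y N)) t) \<longlonglongrightarrow> char (distr P borel (\<lambda>\<omega>. L (\<Xi> \<omega>))) t"
      unfolding tendsto_iff
    proof safe
      fix e :: real assume "e > 0"
      \<comment> \<open>The \<open>+ 1\<close> covers \<open>t = 0\<close> and makes the resulting
        bound strict.\<close>
      define e' where "e' = e / (\<bar>t\<bar> + 1)"
      have "e' > 0" using \<open>e > 0\<close> by (simp add: e'_def add_nonneg_pos)
      have "\<bar>t\<bar> * e' < e" using \<open>e > 0\<close> by (simp add: e'_def field_simps)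
      from eventually_nn_integral_partial_le[OF LX_meas Y_meas le K(1) \<open>e' > 0\<close>]
      show "\<forall>\<^sub>F N in sequentially. dist (char (distr P borel (Y N)) t)
          (char (distr P borel (\<lambda>\<omega>. L (\<Xi> \<omega>))) t) < e"
      proof eventually_elim
        case (elim N)
        then have "norm (char (distr P borel (\<lambda>\<omega>. L (\<Xi> \<omega>))) t - char (distr P borel (Y N)) t)
            \<le> \<bar>t\<bar> * e'"
          using \<open>e' > 0\<close> by (intro norm_char_diff_le) auto
        then show ?case
          using \<open>\<bar>t\<bar> * e' < e\<close> by (simp add: dist_norm norm_minus_commute)
      qed
    qed
    have "(\<lambda>N. complex_of_real (exp (- (sum \<sigma> (walsh_cube N) * t\<^sup>2) / 2)))
        \<longlonglongrightarrow> complex_of_real (exp (- (s * t\<^sup>2) / 2))"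
      by (intro tendsto_intros s_lim) simp
    moreover have "char (distr P borel (Y N)) t =
        complex_of_real (exp (- (sum \<sigma> (walsh_cube N) * t\<^sup>2) / 2))" for N
      using char_sum_inner_\<xi>[of "walsh_cube N" v t, OF walsh_cube_props(2)] by (simp add: Y_def[abs_def] \<sigma>_def)
    ultimately show "(\<lambda>N. char (distr P borel (Y N)) t) \<longlonglongrightarrow> char (normal_law 0 s) t"
      by (simp only: char_normal_law[OF \<open>s \<ge> 0\<close>])
  qed
  then have eq: "distr P borel (\<lambda>\<omega>. L (\<Xi> \<omega>)) = normal_law 0 s"
    by (intro Levy_uniqueness real_distribution_normal_law real_distribution_distr \<open>s \<ge> 0\<close>)
      auto
  have "s > 0" if "L \<noteq> (\<lambda>_. 0)"
  proof -
    have "\<exists>I\<in>walsh_index. v I \<noteq> 0"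
    proof (rule ccontr)
      assume *: "\<not> (\<exists>I\<in>walsh_index. v I \<noteq> 0)"
      have "L = (\<lambda>_. 0)"
        by (rule walsh_total[OF assms]) (use * v in force)
      with that show False ..
    qed
    then obtain I where I: "I \<in> walsh_index" "v I \<noteq> 0" by blast
    have "0 < (\<alpha> I)\<^sup>2 * (norm (v I))\<^sup>2"
      using \<alpha>_pos[OF I(1)] I(2) by simp
    also have "\<dots> \<le> \<sigma> I"
      unfolding \<sigma>_def by (rule quadratic_form_bounds(1)[OF I(1)])
    also have "\<sigma> I = infsum \<sigma> {I}" by simp
    also have "\<dots> \<le> s"
      unfolding s_def using \<sigma>_summable \<sigma>_nonneg I(1)
      by (intro infsum_mono2) auto
    finally show ?thesis .
  qed
  with eq \<open>s \<ge> 0\<close> show ?thesis by blast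
qed

lemma nondegenerate_gaussian_\<Xi>: "nondegenerate_gaussian (distr P borel \<Xi>)"
proof -
  have meas: "L \<in> borel_measurable borel" if "bounded_linear L" for L :: "(real^'d) cube_L2 \<Rightarrow> real"
    by (rule borel_measurable_continuous_onI[OF bounded_linear.continuous_on[OF that continuous_on_id]])
  have L: "\<exists>s\<ge>0. distr (distr P borel \<Xi>) borel L = normal_law 0 s \<and> (L \<noteq> (\<lambda>_. 0) \<longrightarrow> s > 0)"
    if "bounded_linear L" for L
    using distr_functional_\<Xi>[OF that] meas[OF that] by (simp add: distr_distr comp_def)
  have "gaussian_measure (distr P borel \<Xi>)"
    unfolding gaussian_measure_def
  proof (intro conjI allI impI)
    show "\<exists>m s2. s2 \<ge> 0 \<and> distr (distr P borel \<Xi>) borel L = normal_law m s2"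
      if "bounded_linear L" for L
      using L[OF that] by blast
  qed (simp_all add: prob_space_distr)
  then show ?thesis
    unfolding nondegenerate_gaussian_def
  proof (intro conjI allI impI)
    show "\<exists>m s2. s2 > 0 \<and> distr (distr P borel \<Xi>) borel L = normal_law m s2"
      if "bounded_linear L \<and> L \<noteq> (\<lambda>_. 0)" for L
      using L[of L] that by blast
  qed
qed

section \<open>Expected energy of the partial sums and of the series\<close>

lemma A_pos: "n \<ge> 1 \<Longrightarrow> A n > 0"
  and A_square: "n \<ge> 1 \<Longrightarrow> (A n)\<^sup>2 = (\<Sum>I\<in>walsh_index_max n. (\<alpha> I)\<^sup>2)"
proof -
  assume n: "n \<ge> 1"
  have "{n} \<in> walsh_index_max n" using n by (auto simp: walsh_index_max_def walsh_index_def)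
  then have "0 < (\<Sum>I\<in>walsh_index_max n. (\<alpha> I)\<^sup>2)"
    using \<alpha>_pos finite_walsh_index_max by (intro sum_pos) (auto simp: walsh_index_max_def)
  then show "A n > 0" "(A n)\<^sup>2 = (\<Sum>I\<in>walsh_index_max n. (\<alpha> I)\<^sup>2)"
    using A_eq[OF n] by auto
qed

text \<open>If \<open>q\<close> and \<open>q'\<close> first differ at coordinate \<open>n\<close>, every \<open>W\<^sub>I\<close> with \<open>Max I = n\<close> changes sign, so
  the variances with these indices survive in the difference.\<close>

lemma expectation_kernel_partial_le:
  assumes n: "1 \<le> n" "n \<le> N" and "r > 0" and q: "q \<in> space cube_measure"
    and eq: "\<And>i. i \<in> {1..<n} \<Longrightarrow> q' i = q i" and neq: "q' n = - q n"
  shows "expectation (\<lambda>\<omega>. exp (- (dist (partial N \<omega> q) (partial N \<omega> q'))\<^sup>2 / (2 * r\<^sup>2)))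
    \<le> (r / A n) ^ CARD('d)"
proof -
  define c where "c I = walsh I q - walsh I q'" for I
  define Y where "Y \<omega> = (\<Sum>I\<in>walsh_cube N. c I *\<^sub>R \<xi> I \<omega>)" for \<omega>
  define V where "V v = (\<Sum>I\<in>walsh_cube N. (\<Sigma> I *v (c I *\<^sub>R v)) \<bullet> (c I *\<^sub>R v))" for v
  have cube: "I \<in> walsh_cube N \<Longrightarrow> I \<in> walsh_index" for I
    using walsh_cube_props(2) by auto
  have [measurable]: "Y \<in> borel_measurable P"
    unfolding Y_def by (intro borel_measurable_sum borel_measurable_scaleR) (auto intro: cube measurable_\<xi>)
  have inner_Y: "v \<bullet> Y \<omega> = (\<Sum>I\<in>walsh_cube N. (c I *\<^sub>R v) \<bullet> \<xi> I \<omega>)" for v \<omega>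
    by (simp add: Y_def inner_sum_right)
  have "expectation (\<lambda>\<omega>. exp (- (norm (Y \<omega>))\<^sup>2 / (2 * r\<^sup>2))) \<le> (r / A n) ^ DIM(real^'d)"
  proof (rule expectation_gaussian_kernel_le)
    show "A n > 0" by (rule A_pos) (rule n)
    fix v
    have "char (distr P borel (\<lambda>\<omega>. v \<bullet> Y \<omega>)) 1 = complex_of_real (exp (- V v / 2))"
      unfolding inner_Y using char_sum_inner_\<xi>[of "walsh_cube N" "\<lambda>I. c I *\<^sub>R v" 1, OF walsh_cube_props(2)]
      by (simp add: V_def)
    then show "(CLINT \<omega>|P. iexp (v \<bullet> Y \<omega>)) = complex_of_real (exp (- V v / 2))"
      by (simp add: char_def integral_distr)
    have "(A n)\<^sup>2 * (norm v)\<^sup>2 = (\<Sum>I\<in>walsh_index_max n. (\<alpha> I)\<^sup>2 * (norm v)\<^sup>2)"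
      using n by (simp add: A_square sum_distrib_right)
    also have "\<dots> \<le> (\<Sum>I\<in>walsh_index_max n. (\<Sigma> I *v (c I *\<^sub>R v)) \<bullet> (c I *\<^sub>R v))"
    proof (rule sum_mono)
      fix I assume I: "I \<in> walsh_index_max n"
      then have I': "I \<in> walsh_index" by (simp add: walsh_index_max_def)
      \<comment> \<open>The sign change gains a factor 4 in the variance, which the comparison below
        discards.\<close>
      have "c I = 2 * walsh I q"
        using walsh_flip_last[OF I, of q' q] eq neq by (simp add: c_def)
      then have "\<bar>c I\<bar> = 2"
        using abs_walsh[OF I' q] by (simp add: abs_mult)
      then have "(norm v)\<^sup>2 \<le> (norm (c I *\<^sub>R v))\<^sup>2"
        by (intro power_mono) auto
      then have "(\<alpha> I)\<^sup>2 * (norm v)\<^sup>2 \<le> (\<alpha> I)\<^sup>2 * (norm (c I *\<^sub>R v))\<^sup>2"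
        by (intro mult_left_mono) auto
      also have "\<dots> \<le> (\<Sigma> I *v (c I *\<^sub>R v)) \<bullet> (c I *\<^sub>R v)"
        by (rule quadratic_form_bounds(1)[OF I'])
      finally show "(\<alpha> I)\<^sup>2 * (norm v)\<^sup>2 \<le> (\<Sigma> I *v (c I *\<^sub>R v)) \<bullet> (c I *\<^sub>R v)" .
    qed
    \<comment> \<open>All other indices contribute nonnegative variance; \<open>n \<le> N\<close>
      ensures that the whole level occurs in the partial sum.\<close>
    also have "\<dots> \<le> V v"
      unfolding V_def
      by (intro sum_mono2 walsh_cube_props walsh_index_max_subset_cube n)
        (blast intro: quadratic_form_nonneg cube)
    finally show "(A n)\<^sup>2 * (norm v)\<^sup>2 \<le> V v" .
  qed (use \<open>r > 0\<close> in auto)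
  moreover have "dist (partial N \<omega> q) (partial N \<omega> q') = norm (Y \<omega>)" for \<omega>
    by (simp add: dist_norm partial_def Y_def c_def scaleR_diff_left sum_subtractf)
  ultimately show ?thesis by simp
qed

definition energy_constant :: real where
  "energy_constant = (\<Sum>\<^sub>\<infinity>n\<in>{1..}. 1 / (2 ^ n * A n ^ CARD('d)))"

lemma energy_constant_nonneg: "0 \<le> energy_constant"
  unfolding energy_constant_def using A_pos by (intro infsum_nonneg) (auto simp: less_imp_le)

text \<open>Pairs of points are sorted by their first difference. If there is none among the first N
  coordinates, the kernel is only bounded by 1, which costs 2^-N. Measurability is read off the
  integral of the explicit kernel and does not pass through the class-valued map.\<close>

lemma measurable_energy_partial [measurable]:
  "(\<lambda>\<omega>. gaussian_energy r (measure_of_prob2 (iota (abs_cube_L2 (partial N \<omega>)))))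
    \<in> borel_measurable P" (is ?meas)
  and nn_integral_energy_partial_le:
  "r > 0 \<Longrightarrow> (\<integral>\<^sup>+\<omega>. ennreal (gaussian_energy r (measure_of_prob2 (iota (abs_cube_L2 (partial N \<omega>))))) \<partial>P)
    \<le> ennreal (energy_constant * r ^ CARD('d) + (1 / 2) ^ N)"
proof -
  let ?QQ = "cube_measure \<Otimes>\<^sub>M cube_measure"
  interpret QQ: pair_prob_space cube_measure cube_measure ..
  interpret T: pair_prob_space P ?QQ ..
  define k where "k \<omega> z = exp (- (dist (partial N \<omega> (fst z)) (partial N \<omega> (snd z)))\<^sup>2 / (2 * r\<^sup>2))" for \<omega> z
  have partial_meas [measurable]: "partial N \<omega> \<in> borel_measurable cube_measure" for \<omega>
    using square_integrable_partial by (simp add: square_integrable_def)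
  have energy: "gaussian_energy r (measure_of_prob2 (iota (abs_cube_L2 (partial N \<omega>)))) =
      (\<integral>z. k \<omega> z \<partial>?QQ)" for \<omega>
    unfolding measure_of_prob2_iota[OF square_integrable_partial] k_def
    by (rule gaussian_energy_distr) (auto intro: prob_space_cube_measure)
  have pairs: "(\<lambda>w. (fst w, fst (snd w))) \<in> measurable (P \<Otimes>\<^sub>M ?QQ) (P \<Otimes>\<^sub>M cube_measure)"
    "(\<lambda>w. (fst w, snd (snd w))) \<in> measurable (P \<Otimes>\<^sub>M ?QQ) (P \<Otimes>\<^sub>M cube_measure)"
    by measurable
  have [measurable]: "(\<lambda>w. partial N (fst w) (fst (snd w))) \<in> borel_measurable (P \<Otimes>\<^sub>M ?QQ)"
    "(\<lambda>w. partial N (fst w) (snd (snd w))) \<in> borel_measurable (P \<Otimes>\<^sub>M ?QQ)"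
    using pairs[THEN measurable_compose[OF _ measurable_partial[of N]]] by simp_all
  have k_meas [measurable]: "case_prod k \<in> borel_measurable (P \<Otimes>\<^sub>M ?QQ)"
    unfolding k_def case_prod_beta' by measurable
  show ?meas
    unfolding energy by measurable
  assume "r > 0"
  \<comment> \<open>Coordinates are signs, so differing at \<open>n\<close> means being opposite
    there; together with \<open>E\<close> the sets with \<open>n\<close> from 1 to \<open>N\<close>
    cover all pairs.\<close>
  define D where "D n = {z \<in> space ?QQ. \<forall>i\<in>{1..n}. snd z i = (if i = n then -1 else 1) * fst z i}" for n :: nat
  define E where "E = {z \<in> space ?QQ. \<forall>i\<in>{1..N}. snd z i = 1 * fst z i}"
  have D: "D n \<in> sets ?QQ" "emeasure ?QQ (D n) = ennreal ((1 / 2) ^ n)" for n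
    unfolding D_def by (rule emeasure_cube_pair_cylinder; simp)+
  have E: "E \<in> sets ?QQ" "emeasure ?QQ E = ennreal ((1 / 2) ^ N)"
    unfolding E_def by (rule emeasure_cube_pair_cylinder; simp)+
  have k_int: "integrable P (\<lambda>\<omega>. k \<omega> z)" if "z \<in> space ?QQ" for z
  proof (rule integrable_const_bound[where B=1])
    show "(\<lambda>\<omega>. k \<omega> z) \<in> borel_measurable P"
      using measurable_compose[OF measurable_Pair2'[OF that] k_meas] by simp
  qed (simp add: k_def)
  have pointwise: "(\<integral>\<^sup>+\<omega>. ennreal (k \<omega> z) \<partial>P) \<le>
      (\<Sum>n\<in>{1..N}. ennreal ((r / A n) ^ CARD('d)) * indicator (D n) z) + indicator E z"
    if z: "z \<in> space ?QQ" for z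
  proof (cases "z \<in> E")
    case True
    have "(\<integral>\<^sup>+\<omega>. ennreal (k \<omega> z) \<partial>P) \<le> (\<integral>\<^sup>+\<omega>. 1 \<partial>P)"
      by (intro nn_integral_mono) (simp add: k_def)
    then show ?thesis
      using True by (simp add: emeasure_space_1 add_increasing)
  next
    case False
    have q: "fst z \<in> space cube_measure" "snd z \<in> space cube_measure"
      using z by (auto simp: space_pair_measure)
    have "\<exists>i. i \<in> {1..N} \<and> snd z i \<noteq> fst z i"
      using False z by (auto simp: E_def)
    then obtain n where n: "n \<in> {1..N}" "snd z n \<noteq> fst z n"
      and min: "\<And>i. i < n \<Longrightarrow> \<not> (i \<in> {1..N} \<and> snd z i \<noteq> fst z i)"
      using exists_least_iff[of "\<lambda>i. i \<in> {1..N} \<and> snd z i \<noteq> fst z i"] by blast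
    have eq: "snd z i = fst z i" if "i \<in> {1..<n}" for i
      using min[of i] that n by auto
    have neq: "snd z n = - fst z n"
      using n cube_component_cases[OF q(1), of n] cube_component_cases[OF q(2), of n] by auto
    have "z \<in> D n" using z eq neq by (auto simp: D_def)
    have "(\<integral>\<^sup>+\<omega>. ennreal (k \<omega> z) \<partial>P) = ennreal (expectation (\<lambda>\<omega>. k \<omega> z))"
      using k_int[OF z] by (intro nn_integral_eq_integral) (auto simp: k_def)
    also have "\<dots> \<le> ennreal ((r / A n) ^ CARD('d))"
      unfolding k_def using n eq neq q \<open>r > 0\<close>
      by (intro ennreal_leI expectation_kernel_partial_le) auto
    also have "\<dots> = ennreal ((r / A n) ^ CARD('d)) * indicator (D n) z"
      using \<open>z \<in> D n\<close> by simp
    also have "\<dots> \<le> (\<Sum>n\<in>{1..N}. ennreal ((r / A n) ^ CARD('d)) * indicator (D n) z)"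
      using n by (intro member_le_sum) auto
    finally show ?thesis by (simp add: add_increasing2)
  qed
  have "(\<integral>\<^sup>+\<omega>. ennreal (gaussian_energy r (measure_of_prob2 (iota (abs_cube_L2 (partial N \<omega>))))) \<partial>P)
      = (\<integral>\<^sup>+\<omega>. (\<integral>\<^sup>+z. ennreal (k \<omega> z) \<partial>?QQ) \<partial>P)"
  proof (rule nn_integral_cong)
    fix \<omega>
    have [measurable]: "k \<omega> \<in> borel_measurable ?QQ"
      unfolding k_def by measurable
    have "integrable ?QQ (k \<omega>)"
      by (rule QQ.integrable_const_bound[where B=1]) (auto simp: k_def)
    then show "ennreal (gaussian_energy r (measure_of_prob2 (iota (abs_cube_L2 (partial N \<omega>)))))
        = (\<integral>\<^sup>+z. ennreal (k \<omega> z) \<partial>?QQ)"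
      unfolding energy by (intro nn_integral_eq_integral[symmetric]) (auto simp: k_def)
  qed
  also have "\<dots> = (\<integral>\<^sup>+z. (\<integral>\<^sup>+\<omega>. ennreal (k \<omega> z) \<partial>P) \<partial>?QQ)"
    by (rule T.Fubini'[symmetric]) measurable
  also have "\<dots> \<le> (\<integral>\<^sup>+z. (\<Sum>n\<in>{1..N}. ennreal ((r / A n) ^ CARD('d)) * indicator (D n) z) + indicator E z \<partial>?QQ)"
    by (intro nn_integral_mono pointwise)
  also have "\<dots> = (\<Sum>n\<in>{1..N}. ennreal ((r / A n) ^ CARD('d)) * ennreal ((1 / 2) ^ n)) + ennreal ((1 / 2) ^ N)"
    using D E
    by (simp add: nn_integral_add nn_integral_sum nn_integral_cmult
        del: sum_mult_indicator)
  also have "(\<Sum>n\<in>{1..N}. ennreal ((r / A n) ^ CARD('d)) * ennreal ((1 / 2) ^ n)) =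
      ennreal (\<Sum>n\<in>{1..N}. (r / A n) ^ CARD('d) * (1 / 2) ^ n)"
  proof -
    have "0 \<le> (r / A n) ^ CARD('d)" if "n \<in> {1..N}" for n
      using A_pos[of n] that \<open>r > 0\<close> by (intro zero_le_power) simp
    then show ?thesis
      by (subst sum_ennreal[symmetric]) (auto simp: ennreal_mult)
  qed
  also have "(\<Sum>n\<in>{1..N}. (r / A n) ^ CARD('d) * (1 / 2) ^ n) =
      r ^ CARD('d) * (\<Sum>n\<in>{1..N}. 1 / (2 ^ n * A n ^ CARD('d)))"
    by (simp add: sum_distrib_left power_divide mult_ac)
  also have "ennreal \<dots> \<le> ennreal (r ^ CARD('d) * energy_constant)"
  proof (intro ennreal_leI mult_left_mono)
    show "(\<Sum>n\<in>{1..N}. 1 / (2 ^ n * A n ^ CARD('d))) \<le> energy_constant"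
      unfolding energy_constant_def using A_summable A_pos
      by (intro finite_sum_le_infsum) (auto simp: less_imp_le)
  qed (use \<open>r > 0\<close> in simp)
  finally have le: "(\<integral>\<^sup>+\<omega>. ennreal (gaussian_energy r (measure_of_prob2 (iota (abs_cube_L2 (partial N \<omega>))))) \<partial>P)
      \<le> ennreal (r ^ CARD('d) * energy_constant) + ennreal ((1 / 2) ^ N)"
    by (simp add: add_right_mono)
  show "(\<integral>\<^sup>+\<omega>. ennreal (gaussian_energy r (measure_of_prob2 (iota (abs_cube_L2 (partial N \<omega>))))) \<partial>P)
      \<le> ennreal (energy_constant * r ^ CARD('d) + (1 / 2) ^ N)"
    using le energy_constant_nonneg \<open>r > 0\<close> by (simp add: mult.commute flip: ennreal_plus)
qed

text \<open>The Lipschitz constant \<open>2 / r\<close> blows up for small radii, but the radius is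
  fixed while N grows: the energies converge in L1 and the error 2^-N disappears.\<close>

lemma nn_integral_energy_\<Xi>_le:
  assumes "r > 0"
  shows "(\<integral>\<^sup>+\<omega>. ennreal (gaussian_energy r (measure_of_prob2 (iota (\<Xi> \<omega>)))) \<partial>P)
    \<le> ennreal (energy_constant * r ^ CARD('d))"
proof (rule ennreal_le_epsilon)
  fix e :: real assume "e > 0"
  define J where "J X = gaussian_energy r (measure_of_prob2 (iota X))" for X :: "(real^'d) cube_L2"
  note [measurable] = borel_measurable_gaussian_energy[OF assms]
  have J_\<Xi> [measurable]: "(\<lambda>\<omega>. J (\<Xi> \<omega>)) \<in> borel_measurable P"
    unfolding J_def by measurable
  have J_partial [measurable]: "(\<lambda>\<omega>. J (abs_cube_L2 (partial N \<omega>))) \<in> borel_measurable P" for N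
    unfolding J_def by measurable
  have "\<bar>J X - J Y\<bar> \<le> 2 / r * norm (X - Y)" for X Y
    unfolding J_def
    using gaussian_energy_W2_Lipschitz[OF assms, of "iota X" "iota Y"]
      mult_left_mono[OF W2_iota_le[of X Y], of "2 / r"] assms by simp
  then have "\<forall>\<^sub>F N in sequentially. (\<integral>\<^sup>+\<omega>. ennreal \<bar>J (\<Xi> \<omega>) - J (abs_cube_L2 (partial N \<omega>))\<bar> \<partial>P) \<le> ennreal (e / 2)"
    using assms \<open>e > 0\<close>
    by (intro eventually_nn_integral_partial_le[OF J_\<Xi> J_partial, where K="2 / r"]) auto
  moreover have "\<forall>\<^sub>F N in sequentially. (1 / 2 :: real) ^ N < e / 2"
    using \<open>e > 0\<close> by (intro order_tendstoD(2)[OF LIMSEQ_power_zero]) auto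
  ultimately have "\<forall>\<^sub>F N in sequentially. (\<integral>\<^sup>+\<omega>. ennreal \<bar>J (\<Xi> \<omega>) - J (abs_cube_L2 (partial N \<omega>))\<bar> \<partial>P) \<le> ennreal (e / 2)
      \<and> (1 / 2 :: real) ^ N < e / 2"
    by (rule eventually_conj)
  then obtain N where N: "(\<integral>\<^sup>+\<omega>. ennreal \<bar>J (\<Xi> \<omega>) - J (abs_cube_L2 (partial N \<omega>))\<bar> \<partial>P) \<le> ennreal (e / 2)"
    "(1 / 2 :: real) ^ N < e / 2"
    using eventually_happens by force
  have "(\<integral>\<^sup>+\<omega>. ennreal (J (\<Xi> \<omega>)) \<partial>P) \<le> (\<integral>\<^sup>+\<omega>. ennreal (J (abs_cube_L2 (partial N \<omega>))) +
      ennreal \<bar>J (\<Xi> \<omega>) - J (abs_cube_L2 (partial N \<omega>))\<bar> \<partial>P)"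
  proof (rule nn_integral_mono)
    fix \<omega>
    have "0 \<le> J (abs_cube_L2 (partial N \<omega>))"
      unfolding J_def by (rule gaussian_energy_nonneg)
    then have "ennreal (J (abs_cube_L2 (partial N \<omega>)) + \<bar>J (\<Xi> \<omega>) - J (abs_cube_L2 (partial N \<omega>))\<bar>) =
        ennreal (J (abs_cube_L2 (partial N \<omega>))) + ennreal \<bar>J (\<Xi> \<omega>) - J (abs_cube_L2 (partial N \<omega>))\<bar>"
      by (intro ennreal_plus) auto
    moreover have "ennreal (J (\<Xi> \<omega>)) \<le>
        ennreal (J (abs_cube_L2 (partial N \<omega>)) + \<bar>J (\<Xi> \<omega>) - J (abs_cube_L2 (partial N \<omega>))\<bar>)"
      by (rule ennreal_leI) simp
    ultimately show "ennreal (J (\<Xi> \<omega>)) \<le> ennreal (J (abs_cube_L2 (partial N \<omega>))) +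
        ennreal \<bar>J (\<Xi> \<omega>) - J (abs_cube_L2 (partial N \<omega>))\<bar>"
      by simp
  qed
  also have "\<dots> = (\<integral>\<^sup>+\<omega>. ennreal (J (abs_cube_L2 (partial N \<omega>))) \<partial>P) +
      (\<integral>\<^sup>+\<omega>. ennreal \<bar>J (\<Xi> \<omega>) - J (abs_cube_L2 (partial N \<omega>))\<bar> \<partial>P)"
    by (rule nn_integral_add) measurable
  also have "\<dots> \<le> ennreal (energy_constant * r ^ CARD('d) + (1 / 2) ^ N) + ennreal (e / 2)"
    using nn_integral_energy_partial_le[OF assms, of N] N(1) by (intro add_mono) (auto simp: J_def)
  also have "\<dots> = ennreal (energy_constant * r ^ CARD('d) + (1 / 2) ^ N + e / 2)"
    using energy_constant_nonneg assms \<open>e > 0\<close> by (intro ennreal_plus[symmetric]) auto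
  also have "\<dots> \<le> ennreal (energy_constant * r ^ CARD('d) + e)"
    using N(2) by (intro ennreal_leI) simp
  also have "\<dots> = ennreal (energy_constant * r ^ CARD('d)) + ennreal e"
    using energy_constant_nonneg assms \<open>e > 0\<close> by (intro ennreal_plus) auto
  finally show "(\<integral>\<^sup>+\<omega>. ennreal (gaussian_energy r (measure_of_prob2 (iota (\<Xi> \<omega>)))) \<partial>P)
      \<le> ennreal (energy_constant * r ^ CARD('d)) + ennreal e"
    by (simp add: J_def)
qed

text \<open>Fatou's lemma is applied on the Wasserstein space, where the energies are Borel functions.\<close>

lemma AE_P2r: "AE \<mu> in distr P borel (\<lambda>\<omega>. iota (\<Xi> \<omega>)). \<mu> \<in> P2r"
proof -
  let ?M = "distr P borel (\<lambda>\<omega>. iota (\<Xi> \<omega>))"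
  define r :: "nat \<Rightarrow> real" where "r k = 1 / real (Suc k)" for k
  have r: "r k > 0" for k by (simp add: r_def)
  have r0: "r \<longlonglongrightarrow> 0"
    unfolding r_def using LIMSEQ_inverse_real_of_nat by (simp add: inverse_eq_divide)
  \<comment> \<open>Normalised so that the means are bounded by \<open>energy_constant\<close>
    uniformly in \<open>k\<close>.\<close>
  define u where "u k \<mu> = ennreal (gaussian_energy (r k) (measure_of_prob2 \<mu>) / r k ^ CARD('d))"
    for k and \<mu> :: "(real^'d) prob2"
  note [measurable] = borel_measurable_gaussian_energy[OF r]
  have u_meas [measurable]: "u k \<in> borel_measurable borel" for k
    unfolding u_def by measurable
  have u_le: "(\<integral>\<^sup>+\<mu>. u k \<mu> \<partial>?M) \<le> ennreal energy_constant" for k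
  proof -
    have "(\<integral>\<^sup>+\<mu>. u k \<mu> \<partial>?M) = (\<integral>\<^sup>+\<omega>. u k (iota (\<Xi> \<omega>)) \<partial>P)"
      by (rule nn_integral_distr) measurable
    also have "\<dots> = (\<integral>\<^sup>+\<omega>. ennreal (1 / r k ^ CARD('d)) *
        ennreal (gaussian_energy (r k) (measure_of_prob2 (iota (\<Xi> \<omega>)))) \<partial>P)"
      unfolding u_def using r[of k]
      by (intro nn_integral_cong, subst ennreal_mult[symmetric])
        (auto simp: gaussian_energy_nonneg)
    also have "\<dots> = ennreal (1 / r k ^ CARD('d)) *
        (\<integral>\<^sup>+\<omega>. ennreal (gaussian_energy (r k) (measure_of_prob2 (iota (\<Xi> \<omega>)))) \<partial>P)"
      by (rule nn_integral_cmult) measurable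
    also have "\<dots> \<le> ennreal (1 / r k ^ CARD('d)) * ennreal (energy_constant * r k ^ CARD('d))"
      by (intro mult_left_mono nn_integral_energy_\<Xi>_le r) simp
    also have "\<dots> = ennreal energy_constant"
      using r[of k] by (simp flip: ennreal_mult')
    finally show ?thesis .
  qed
  have "(\<integral>\<^sup>+\<mu>. liminf (\<lambda>k. u k \<mu>) \<partial>?M) \<le> liminf (\<lambda>k. \<integral>\<^sup>+\<mu>. u k \<mu> \<partial>?M)"
    by (rule nn_integral_liminf) measurable
  also have "\<dots> \<le> ennreal energy_constant"
    using u_le by (intro Liminf_le) auto
  finally have "(\<integral>\<^sup>+\<mu>. liminf (\<lambda>k. u k \<mu>) \<partial>?M) \<noteq> \<infinity>"
    by (auto simp: top_unique)
  then have "AE \<mu> in ?M. liminf (\<lambda>k. u k \<mu>) \<noteq> \<infinity>"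
    by (intro nn_integral_noteq_infinite) measurable
  then show ?thesis
  proof (rule eventually_mono)
    fix \<mu> :: "(real^'d) prob2" assume "liminf (\<lambda>k. u k \<mu>) \<noteq> \<infinity>"
    then obtain c where c: "liminf (\<lambda>k. u k \<mu>) = ennreal c" "c \<ge> 0"
      by (cases "liminf (\<lambda>k. u k \<mu>)") auto
    \<comment> \<open>A number strictly above the lower limit is undercut for infinitely many
      \<open>k\<close>. It may depend on \<open>\<mu>\<close>, since the criterion is applied to
      each measure separately.\<close>
    define C where "C = c + 1"
    have C: "liminf (\<lambda>k. u k \<mu>) < ennreal C" "C > 0"
      using c by (auto simp: C_def ennreal_less_iff)
    have "\<exists>\<^sub>F k in sequentially. u k \<mu> < ennreal C"
      using C Liminf_bounded[of "ennreal C" "\<lambda>k. u k \<mu>" sequentially]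
      by (auto simp: frequently_def not_less)
    then have "\<exists>\<^sub>F k in sequentially. gaussian_energy (r k) (measure_of_prob2 \<mu>)
        \<le> C * r k ^ DIM(real^'d)"
    proof (rule frequently_elim1)
      fix k assume "u k \<mu> < ennreal C"
      then have "gaussian_energy (r k) (measure_of_prob2 \<mu>) / r k ^ CARD('d) < C"
        unfolding u_def using r[of k]
        by (subst (asm) ennreal_less_iff) (auto simp: gaussian_energy_nonneg)
      then show "gaussian_energy (r k) (measure_of_prob2 \<mu>) \<le> C * r k ^ DIM(real^'d)"
        using r[of k] by (simp add: field_simps)
    qed
    then have "absolutely_continuous lborel (measure_of_prob2 \<mu>)"
      using r r0 measure_of_prob2_props(1,2)[of \<mu>]
      by (intro absolutely_continuous_of_gaussian_energy) auto
    then show "\<mu> \<in> P2r"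
      unfolding P2r_def using measure_of_prob2_props(2)[of \<mu>]
      by (auto intro: emeasure_dc_hypersurface_eq_0)
  qed
qed

section \<open>Super-G-regularity of the image law\<close>

lemma distr_iota_in_P2: "distr P borel (\<lambda>\<omega>. iota (\<Xi> \<omega>)) \<in> P2 W2"
proof -
  \<comment> \<open>The base point is the Dirac mass at the origin, from which the distance to an
    image under \<open>iota\<close> is at most the Hilbert norm.\<close>
  have "(\<integral>\<^sup>+\<mu>. ennreal ((W2 \<mu> (iota 0))\<^sup>2) \<partial>distr P borel (\<lambda>\<omega>. iota (\<Xi> \<omega>)))
      \<le> (\<integral>\<^sup>+\<omega>. ennreal ((W2 (iota (\<Xi> \<omega>)) (iota 0))\<^sup>2) \<partial>P)"
    by (rule nn_integral_distr_le) measurable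
  also have "\<dots> \<le> (\<integral>\<^sup>+\<omega>. ennreal ((norm (\<Xi> \<omega>))\<^sup>2) \<partial>P)"
  proof (intro nn_integral_mono ennreal_leI power_mono)
    show "W2 (iota (\<Xi> \<omega>)) (iota 0) \<le> norm (\<Xi> \<omega>)" for \<omega>
      using W2_iota_le[of "\<Xi> \<omega>" 0] by simp
  qed (simp add: W2_eq)
  also have "\<dots> < \<infinity>" by (rule nn_integral_norm_\<Xi>_finite)
  finally show ?thesis
    unfolding P2_def by (auto intro!: prob_space_distr)
qed

text \<open>For condition (ii), the mass of \<open>B\<close> is the mass of its preimage under
  \<open>iota\<close> for the law of \<open>\<Xi>\<close>, and that law is among the measures over
  which \<open>gaussian_null\<close> quantifies.\<close>

lemma super_G_regular_iota: "super_G_regular (distr (distr P borel \<Xi>) borel iota)"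
proof -
  have eq: "distr (distr P borel \<Xi>) borel iota = distr P borel (\<lambda>\<omega>. iota (\<Xi> \<omega>))"
    by (simp add: distr_distr comp_def)
  have null: "emeasure (distr (distr P borel \<Xi>) borel iota) B = 0"
    if [measurable]: "B \<in> sets borel" and "gaussian_null (iota -` B)"
    for B :: "(real^'d) prob2 set"
    using that nondegenerate_gaussian_\<Xi> by (simp add: emeasure_distr gaussian_null_def)
  then show ?thesis
    using distr_iota_in_P2 AE_P2r null unfolding super_G_regular_def eq by blast
qed

end

theorem theorem6p30:
  fixes \<Sigma> :: "nat set \<Rightarrow> real^'d^'d"
    and \<alpha> \<beta> :: "nat set \<Rightarrow> real"
    and P :: "'w measure"
    and \<xi> :: "nat set \<Rightarrow> 'w \<Rightarrow> real^'d"
    and \<Xi> :: "'w \<Rightarrow> (real^'d) cube_L2"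
    and \<gg> :: "(real^'d) cube_L2 measure"
    and A :: "nat \<Rightarrow> real"
  assumes "CARD('d) > 1"
    and "\<And>I. I \<in> walsh_index \<Longrightarrow> transpose (\<Sigma> I) = \<Sigma> I"
    and "\<And>I. I \<in> walsh_index \<Longrightarrow> 0 < (\<alpha> I)\<^sup>2"
    and "\<And>I v. I \<in> walsh_index \<Longrightarrow> norm v = 1 \<Longrightarrow>
           (\<alpha> I)\<^sup>2 \<le> (\<Sigma> I *v v) \<bullet> v \<and> (\<Sigma> I *v v) \<bullet> v \<le> (\<beta> I)\<^sup>2"
    and "(\<lambda>I. (\<beta> I)\<^sup>2) summable_on walsh_index"
    and "prob_space P"
    and "prob_space.indep_vars P (\<lambda>_. borel) \<xi> walsh_index"
    and "\<And>I. I \<in> walsh_index \<Longrightarrow> centered_gaussian (\<Sigma> I) (distr P borel (\<xi> I))"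
    and "is_walsh_series P \<xi> \<Xi>"
    and "\<gg> = distr P borel \<Xi>"
    and "\<And>n. n \<ge> 1 \<Longrightarrow> A n = sqrt (\<Sum>I\<in>walsh_index_max n. (\<alpha> I)\<^sup>2)"
    and "(\<lambda>n. 1 / (2 ^ n * A n ^ CARD('d))) summable_on {1..}"
  shows "super_G_regular (distr \<gg> borel iota)"
proof -
  interpret gaussian_walsh_series P \<Sigma> \<alpha> \<beta> \<xi> \<Xi> A
    by (intro gaussian_walsh_series.intro gaussian_walsh_series_axioms.intro assms)
  show ?thesis
    unfolding \<open>\<gg> = distr P borel \<Xi>\<close> by (rule super_G_regular_iota)
qed

end
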